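(* Let $q\in(0,1)$ and let $a,b,c,d$ be generic complex parameters satisfying the standing assumptions of the context, with dual parameters $\tilde a,\tilde b,\tilde c,\tilde d$. Then the (symmetric) Askey--Wilson function satisfies, as meromorphic functions of $(\gamma,z)\in\mathbb{C}^*\times\mathbb{C}^*$, $$\mathfrak{E}^+(\gamma;z;a,b,c,d)=\frac{(qad^{-1},qa^{-1}d^{-1};q)_\infty}{(ac,a^{-1}c;q)_\infty}\,\frac{G_{qd^{-1}}(z)}{G_c(z)}\,\mathfrak{E}^+(\gamma;z;a,b,qd^{-1},qc^{-1}),$$ $$\mathfrak{E}^+(\gamma;z;a,b,c,d)=\frac{(bc,qa^{-1}d^{-1};q)_\infty}{(ac,qb^{-1}d^{-1};q)_\infty}\,\frac{G_{q\tilde d^{-1}}(\gamma)}{G_{\tilde c}(\gamma)}\,\mathfrak{E}^+(\gamma;z;b,a,c,d).$$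
   Context: Notation: $\mathbb{C}^*=\mathbb{C}\setminus\{0\}$; $q\in(0,1)$ is fixed; $(x;q)_n=\prod_{j=0}^{n-1}(1-xq^j)$ for $n\in\{0,1,2,\dots\}\cup\{\infty\}$, $(x_1,\dots,x_r;q)_n=\prod_i (x_i;q)_n$; ${}_4\phi_3\left({a_1,a_2,a_3,a_4\atop b_1,b_2,b_3};q,q\right)=\sum_{k\ge0}\frac{(a_1,a_2,a_3,a_4;q)_k}{(b_1,b_2,b_3,q;q)_k}q^k$. Square roots are principal on $\mathbb{C}\setminus(-\infty,0]$ (positive on positive reals). Gaussian: $G_e(z)=1/(ez,ez^{-1};q)_\infty$ for $e\in\mathbb{C}^*$. Standing assumptions on parameters: $a,b,c,d\in\mathbb{C}^*$; $a,b,c,d,ab,ab^{-1},cd,cd^{-1}$ have real part $>0$; and $a,b,c,d$ are generic: they and their inverses are all distinct, and no denominator below vanishes identically (it suffices that $xy^{\pm1}\notin q^{\mathbb Z}$ for distinct $x,y$ among the parameters $a,b,c,d$). Dual parameters: $\tilde a=\sqrt{q^{-1}abcd}$, $\tilde b=ab/\tilde a$, $\tilde c=ac/\tilde a$, $\tilde d=ad/\tilde a$. When $\mathfrak{E}^+$ is evaluated at other parameters (e.g. $(a,b,qd^{-1},qc^{-1})$ or $(b,a,c,d)$), the dual parameters in its definition are those of the new parameters. Very-well-poised-balanced series: ${}_8W_7(\alpha;\beta_1,\dots,\beta_5)=\sum_{k\ge0}\frac{1-\alpha q^{2k}}{1-\alpha}\frac{(\alpha,\beta_1,\dots,\beta_5;q)_k}{(q,q\alpha/\beta_1,\dots,q\alpha/\beta_5;q)_k}\left(\frac{q^2\alpha^2}{\beta_1\beta_2\beta_3\beta_4\beta_5}\right)^k$.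 Askey--Wilson function: for $|\gamma|>|q\tilde d^{-1}|$, $$\mathfrak{E}^+(\gamma;z;a,b,c,d)=\frac{(q\gamma\tilde a d^{-1}z,q\gamma\tilde a d^{-1}z^{-1},qad^{-1},qa^{-1}d^{-1};q)_\infty}{(q\gamma\tilde a ad^{-1},\gamma\tilde a^{-1}bc,qd^{-1}z,qd^{-1}z^{-1};q)_\infty}\,{}_8W_7(\gamma\tilde a ad^{-1};az,az^{-1},\gamma\tilde a,\gamma ab\tilde a^{-1},\gamma ac\tilde a^{-1}),$$ and it is extended to a meromorphic function of $(\gamma,z)\in\mathbb{C}^*\times\mathbb{C}^*$, explicitly by the equivalent formula $$\mathfrak{E}^+(\gamma;z;a,b,c,d)={}_4\phi_3\left({az,az^{-1},\tilde a\gamma,\tilde a\gamma^{-1}\atop ab,ac,ad};q,q\right)+\frac{(az,az^{-1},\tilde a\gamma,\tilde a\gamma^{-1},qbd^{-1},qcd^{-1},qa^{-1}d^{-1};q)_\infty}{(qd^{-1}z,qd^{-1}z^{-1},q\tilde d^{-1}\gamma,q\tilde d^{-1}\gamma^{-1},ab,ac,q^{-1}ad;q)_\infty}\,{}_4\phi_3\left({qd^{-1}z,qd^{-1}z^{-1},q\tilde d^{-1}\gamma,q\tilde d^{-1}\gamma^{-1}\atop qbd^{-1},qcd^{-1},q^2a^{-1}d^{-1}};q,q\right).$$ *)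

theory Defs
  imports "HOL-Analysis.Analysis"
begin

text \<open>
  Multi-argument q-shifted factorials: the list holds the arguments
  \<open>x\<^sub>1, \<dots>, x\<^sub>r\<close> of \<open>(x\<^sub>1, \<dots>, x\<^sub>r; q)\<^sub>n\<close>.
\<close>

definition qpoch :: "real \<Rightarrow> complex list \<Rightarrow> nat \<Rightarrow> complex" where
  "qpoch q xs n = (\<Prod>x\<leftarrow>xs. \<Prod>j<n. 1 - x * of_real q ^ j)"

definition qpoch_inf :: "real \<Rightarrow> complex list \<Rightarrow> complex" where
  "qpoch_inf q xs = (\<Prod>x\<leftarrow>xs. \<Prod>j. 1 - x * of_real q ^ j)"

text \<open>The basic hypergeometric series of type \<open>r + 1, r\<close>, for lists of lengths \<open>r + 1\<close> and \<open>r\<close>.\<close>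

definition qhyp :: "real \<Rightarrow> complex list \<Rightarrow> complex list \<Rightarrow> complex \<Rightarrow> complex" where
  "qhyp q xs ys t = (\<Sum>k. qpoch q xs k / qpoch q (ys @ [of_real q]) k * t ^ k)"

text \<open>The very-well-poised-balanced series; \<open>bs\<close> is the list of the five parameters \<open>\<beta>\<^sub>1, \<dots>, \<beta>\<^sub>5\<close>.\<close>

definition W87 :: "real \<Rightarrow> complex \<Rightarrow> complex list \<Rightarrow> complex" where
  "W87 q \<alpha> bs =
     (\<Sum>k. (1 - \<alpha> * of_real q ^ (2 * k)) / (1 - \<alpha>)
           * (qpoch q (\<alpha> # bs) k / qpoch q (of_real q # map (\<lambda>\<beta>. q * \<alpha> / \<beta>) bs) k)
           * (q\<^sup>2 * \<alpha>\<^sup>2 / prod_list bs) ^ k)"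

definition qgauss :: "real \<Rightarrow> complex \<Rightarrow> complex \<Rightarrow> complex" where
  "qgauss q e z = 1 / qpoch_inf q [e * z, e / z]"

definition dual_a :: "real \<Rightarrow> complex \<Rightarrow> complex \<Rightarrow> complex \<Rightarrow> complex \<Rightarrow> complex" where
  "dual_a q a b c d = csqrt (a * b * c * d / q)"

definition dual_b :: "real \<Rightarrow> complex \<Rightarrow> complex \<Rightarrow> complex \<Rightarrow> complex \<Rightarrow> complex" where
  "dual_b q a b c d = a * b / dual_a q a b c d"

definition dual_c :: "real \<Rightarrow> complex \<Rightarrow> complex \<Rightarrow> complex \<Rightarrow> complex \<Rightarrow> complex" where
  "dual_c q a b c d = a * c / dual_a q a b c d"

definition dual_d :: "real \<Rightarrow> complex \<Rightarrow> complex \<Rightarrow> complex \<Rightarrow> complex \<Rightarrow> complex" where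
  "dual_d q a b c d = a * d / dual_a q a b c d"

definition AW_W87 ::
  "real \<Rightarrow> complex \<Rightarrow> complex \<Rightarrow> complex \<Rightarrow> complex \<Rightarrow> complex \<Rightarrow> complex \<Rightarrow> complex" where
  "AW_W87 q a b c d \<gamma> z =
     (let a' = dual_a q a b c d in
        qpoch_inf q [q * \<gamma> * a' * z / d, q * \<gamma> * a' / (d * z), q * a / d, q / (a * d)]
        / qpoch_inf q [q * \<gamma> * a' * a / d, \<gamma> * b * c / a', q * z / d, q / (d * z)]
        * W87 q (\<gamma> * a' * a / d)
            [a * z, a / z, \<gamma> * a', \<gamma> * a * b / a', \<gamma> * a * c / a'])"

definition AW_phi43 ::
  "real \<Rightarrow> complex \<Rightarrow> complex \<Rightarrow> complex \<Rightarrow> complex \<Rightarrow> complex \<Rightarrow> complex \<Rightarrow> complex" where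
  "AW_phi43 q a b c d \<gamma> z =
     (let a' = dual_a q a b c d; d' = dual_d q a b c d in
        qhyp q [a * z, a / z, a' * \<gamma>, a' / \<gamma>] [a * b, a * c, a * d] q
        + qpoch_inf q [a * z, a / z, a' * \<gamma>, a' / \<gamma>, q * b / d, q * c / d, q / (a * d)]
          / qpoch_inf q [q * z / d, q / (d * z), q * \<gamma> / d', q / (d' * \<gamma>),
                         a * b, a * c, a * d / q]
          * qhyp q [q * z / d, q / (d * z), q * \<gamma> / d', q / (d' * \<gamma>)]
              [q * b / d, q * c / d, q\<^sup>2 / (a * d)] q)"

text \<open>
  The domain of the \<open>W87\<close> formula: the series converges for
  \<open>\<bar>\<gamma>\<bar> > \<bar>q / d'\<bar>\<close>, and no denominator depending on \<open>\<gamma>\<close> or \<open>z\<close> may vanish.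
  The first entry of the list covers the factor \<open>1 - \<alpha>\<close> and \<open>(q \<alpha>; q)\<^sub>\<infinity>\<close> for
  \<open>\<alpha> = \<gamma> a' a / d\<close>; the last two are \<open>q \<alpha> / \<beta>\<close> for \<open>\<beta> = a / z\<close> and \<open>\<beta> = a z\<close>. The
  remaining \<open>q \<alpha> / \<beta>\<close> are \<open>q a / d\<close>, \<open>a c\<close> and \<open>a b\<close>.
\<close>

definition AW_W87_dom ::
  "real \<Rightarrow> complex \<Rightarrow> complex \<Rightarrow> complex \<Rightarrow> complex \<Rightarrow> complex \<Rightarrow> complex \<Rightarrow> bool" where
  "AW_W87_dom q a b c d \<gamma> z \<longleftrightarrow>
     (let a' = dual_a q a b c d in
        cmod \<gamma> > cmod (q / dual_d q a b c d) \<and>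
        qpoch_inf q [\<gamma> * a' * a / d, \<gamma> * b * c / a', q * z / d, q / (d * z),
                     q * \<gamma> * a' * z / d, q * \<gamma> * a' / (d * z)] \<noteq> 0)"

text \<open>
  The Askey--Wilson function: given by the \<open>W87\<close> formula, and continued
  meromorphically to all nonzero \<open>\<gamma>\<close> and \<open>z\<close> by the \<open>4\<phi>3\<close> formula.
\<close>

definition AW ::
  "real \<Rightarrow> complex \<Rightarrow> complex \<Rightarrow> complex \<Rightarrow> complex \<Rightarrow> complex \<Rightarrow> complex \<Rightarrow> complex" where
  "AW q a b c d \<gamma> z =
     (if AW_W87_dom q a b c d \<gamma> z then AW_W87 q a b c d \<gamma> z else AW_phi43 q a b c d \<gamma> z)"

text \<open>
  The complement of the polar set of \<open>AW q a b c d\<close>: the nonzero \<open>\<gamma>\<close>, \<open>z\<close> at which no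
  denominator of the \<open>4\<phi>3\<close> formula vanishes. Equality of meromorphic functions is equality
  wherever both sides are free of poles.
\<close>

definition AW_pole_free ::
  "real \<Rightarrow> complex \<Rightarrow> complex \<Rightarrow> complex \<Rightarrow> complex \<Rightarrow> complex \<Rightarrow> complex \<Rightarrow> bool" where
  "AW_pole_free q a b c d \<gamma> z \<longleftrightarrow>
     (let d' = dual_d q a b c d in
        \<gamma> \<noteq> 0 \<and> z \<noteq> 0 \<and>
        qpoch_inf q [q * z / d, q / (d * z), q * \<gamma> / d', q / (d' * \<gamma>)] \<noteq> 0)"

text \<open>
  No denominator of \<open>AW q a b c d\<close> vanishes identically in \<open>\<gamma>\<close> and \<open>z\<close>, i.e. those
  independent of \<open>\<gamma>\<close> and \<open>z\<close> are nonzero; for \<open>(y; q)\<^sub>k\<close> with all \<open>k\<close> this is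
  \<open>(y; q)\<^sub>\<infinity> \<noteq> 0\<close>. The factor \<open>(a d; q)\<^sub>k\<close> is covered by \<open>(a d / q; q)\<^sub>\<infinity>\<close>.
\<close>

definition AW_defined :: "real \<Rightarrow> complex \<Rightarrow> complex \<Rightarrow> complex \<Rightarrow> complex \<Rightarrow> bool" where
  "AW_defined q a b c d \<longleftrightarrow>
     qpoch_inf q [a * b, a * c, a * d / q, q * a / d, q * b / d, q * c / d, q\<^sup>2 / (a * d)] \<noteq> 0"

definition generic_params :: "real \<Rightarrow> complex \<Rightarrow> complex \<Rightarrow> complex \<Rightarrow> complex \<Rightarrow> bool" where
  "generic_params q a b c d \<longleftrightarrow>
     distinct [a, b, c, d, 1 / a, 1 / b, 1 / c, 1 / d] \<and>
     AW_defined q a b c d \<and> AW_defined q a b (q / d) (q / c) \<and> AW_defined q b a c d \<and>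
     qpoch_inf q [a * c, c / a, q / (b * d)] \<noteq> 0"

end

theory Submission
  imports Defs "HOL-Complex_Analysis.Conformal_Mappings"
begin

text \<open>
  Both identities come from one observation. Write \<open>A\<close> for the dual parameter of \<open>a\<close>. Under
  \<open>(a, b, c, d) \<mapsto> (a, b, q/d, q/c)\<close> the parameter \<open>\<gamma>Aa/d\<close> of the very-well-poised series is
  unchanged and its five numerator parameters \<open>az, a/z, \<gamma>A, \<gamma>ab/A, \<gamma>ac/A\<close> are only permuted, so
  the two sides of the first identity are the same series with different prefactors
  (\<open>AW_vwp_symmetry\<close>). The \<open>4\<phi>3\<close> formula is invariant under exchanging \<open>z\<close> with \<open>\<gamma>\<close> and every
  parameter with its dual (\<open>AW_phi_dual\<close>), and the second identity is the first one at the dual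
  parameters.

  Two things remain. The series converges only for \<open>\<bar>\<gamma>\<bar> > \<bar>q/d'\<bar>\<close>, where \<open>d'\<close> is the dual of \<open>d\<close>;
  the first identity reaches the other \<open>\<gamma>\<close> by analytic continuation of the \<open>4\<phi>3\<close> formula,
  multiplied by its \<open>\<gamma>\<close>-dependent denominators, over the punctured plane (\<open>AW_phi_symmetry\<close>). And
  where the series converges it must equal the \<open>4\<phi>3\<close> formula (\<open>AW_vwp_eq_phi\<close>): this is
  Bailey's nonterminating extension of Watson's transformation, \<open>nonterminating_watson\<close>, which
  makes up most of the text.

  The two \<open>4\<phi>3\<close> series of that transformation are the sums over the two lattices \<open>q\<^sup>j\<close> and
  \<open>\<tau>q\<^sup>j\<close> that make up one q-integral from \<open>\<tau>\<close> to \<open>1\<close>. A factor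
  \<open>(\<alpha>qt/b, \<alpha>qt/c; q)\<^sub>\<infinity> / (\<alpha>qt/bc; q)\<^sub>\<infinity>\<close> of the integrand is expanded by the nonterminating very-well-poised
  \<open>6\<phi>5\<close> summation (\<open>vwp_sum_Q_pow\<close> and \<open>vwp_sum_eq\<close>). Each term is then a q-integral evaluated by
  \<open>nonterminating_saalschuetz\<close>, and the result is the very-well-poised series. For \<open>t = q\<^sup>j\<close> the
  expansion is a finite sum, and for \<open>t = \<tau>q\<^sup>j\<close> it has a geometric majorant with the ratio that
  governs the very-well-poised series itself; this justifies the exchange of sums.

  Both summation formulas are solutions of first-order q-difference equations. Each equation is
  proved by telescoping, and iterating it moves the variable to \<open>0\<close>, where everything is
  continuous.
\<close>



section \<open>Exchanging double series\<close>

lemma infsum_nat_eq_suminf: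
  fixes f :: "nat \<Rightarrow> 'a :: banach"
  assumes "summable (\<lambda>n. norm (f n))"
  shows "infsum f UNIV = suminf f"
  by (rule infsumI[OF norm_summable_imp_has_sum[OF assms summable_sums[OF summable_norm_cancel[OF assms]]]])

text \<open>
  A product of two summable sequences as majorant makes the double series absolutely summable.
\<close>

lemma sums_swap:
  fixes a :: "nat \<Rightarrow> nat \<Rightarrow> 'a :: banach"
  assumes le: "\<And>j k. norm (a j k) \<le> r j * M k"
    and r: "summable r" "\<And>j. 0 \<le> r j" and M: "summable M" "\<And>k. 0 \<le> M k"
  shows "(\<lambda>k. \<Sum>j. a j k) sums (\<Sum>j. \<Sum>k. a j k)"
proof -
  have "(\<lambda>(j, k). r j * M k) summable_on UNIV \<times> UNIV"
  proof (rule summable_on_SigmaI[where g = "\<lambda>j. r j * suminf M"])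
    have "(M has_sum suminf M) UNIV"
      using M by (intro sums_nonneg_imp_has_sum summable_sums)
    then show "((\<lambda>k. case (j, k) of (j, k) \<Rightarrow> r j * M k) has_sum r j * suminf M) UNIV" for j
      by (simp add: has_sum_cmult_right)
    show "(\<lambda>j. r j * suminf M) summable_on UNIV"
      using r M by (intro norm_summable_imp_summable_on) (simp add: suminf_nonneg abs_mult summable_mult2)
  qed (use r M in auto)
  then have "(\<lambda>x. norm (case x of (j, k) \<Rightarrow> r j * M k)) summable_on UNIV \<times> UNIV"
    using r M by (simp add: case_prod_unfold abs_mult)
  then have "(\<lambda>x. norm (case x of (j, k) \<Rightarrow> a j k)) summable_on UNIV \<times> UNIV"
    by (rule Infinite_Sum.abs_summable_on_comparison_test)
       (use le r M in \<open>auto simp: abs_mult intro!: order_trans[OF le]\<close>)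
  then have swap: "infsum (\<lambda>j. infsum (\<lambda>k. a j k) UNIV) UNIV = infsum (\<lambda>k. infsum (\<lambda>j. a j k) UNIV) UNIV"
    by (rule infsum_swap_banach[OF Infinite_Sum.abs_summable_summable])
  have row: "summable (\<lambda>k. norm (a j k))" for j
    by (rule summable_comparison_test'[where N = 0 and g = "\<lambda>k. r j * M k"])
       (use le M in \<open>auto intro: summable_mult\<close>)
  have col: "summable (\<lambda>j. norm (a j k))" for k
    by (rule summable_comparison_test'[where N = 0 and g = "\<lambda>j. r j * M k"])
       (use le r in \<open>auto intro: summable_mult2\<close>)
  have le1: "norm (\<Sum>k. a j k) \<le> r j * suminf M" for j
  proof -
    have "norm (\<Sum>k. a j k) \<le> (\<Sum>k. norm (a j k))" by (rule summable_norm[OF row])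
    also have "\<dots> \<le> (\<Sum>k. r j * M k)" by (intro suminf_le le row summable_mult M)
    finally show ?thesis using M by (simp add: suminf_mult)
  qed
  have "summable (\<lambda>j. norm (\<Sum>k. a j k))"
    by (rule summable_comparison_test'[where N = 0 and g = "\<lambda>j. r j * suminf M"])
       (use r le1 in \<open>auto intro: summable_mult2\<close>)
  moreover have le2: "norm (\<Sum>j. a j k) \<le> suminf r * M k" for k
  proof -
    have "norm (\<Sum>j. a j k) \<le> (\<Sum>j. norm (a j k))" by (rule summable_norm[OF col])
    also have "\<dots> \<le> (\<Sum>j. r j * M k)" by (intro suminf_le le col summable_mult2 r)
    finally show ?thesis using r by (simp add: suminf_mult2)
  qed
  have "summable (\<lambda>k. norm (\<Sum>j. a j k))"
    by (rule summable_comparison_test'[where N = 0 and g = "\<lambda>k. suminf r * M k"])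
       (use M le2 in \<open>auto intro: summable_mult\<close>)
  ultimately show ?thesis
    using swap by (simp add: infsum_nat_eq_suminf row col sums_iff summable_norm_cancel)
qed

section \<open>The q-shifted factorials\<close>

locale q_calculus =
  fixes q :: real
  assumes q_pos: "0 < q" and q_less_1: "q < 1"
begin

abbreviation Q :: complex where "Q \<equiv> complex_of_real q"

definition qfin :: "complex \<Rightarrow> nat \<Rightarrow> complex" where
  "qfin x n = (\<Prod>j<n. 1 - x * Q ^ j)"

definition qinf :: "complex \<Rightarrow> complex" where
  "qinf x = (\<Prod>j. 1 - x * Q ^ j)"

lemma Q_nz [simp]: "Q \<noteq> 0" "q \<noteq> 0"
  using q_pos by auto

lemma abs_q [simp]: "\<bar>q\<bar> = q"
  using q_pos by simp

lemma norm_Q [simp]: "norm Q = q"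
  by simp

lemma norm_Q_pow: "norm (Q ^ n) = q ^ n"
  by (simp add: norm_power)

lemma q_pow_le_1: "q ^ n \<le> 1"
  using q_pos q_less_1 by (simp add: power_le_one)

lemma summable_q_pow: "summable (\<lambda>n. q ^ n)"
  using q_pos q_less_1 by (simp add: summable_geometric)

lemma Q_pow_tendsto_0: "(\<lambda>n. Q ^ n) \<longlonglongrightarrow> 0"
  using q_pos q_less_1 by (intro LIMSEQ_power_zero) simp

lemma qfin_0 [simp]: "qfin x 0 = 1"
  by (simp add: qfin_def)

lemma qfin_Suc: "qfin x (Suc n) = qfin x n * (1 - x * Q ^ n)"
  by (simp add: qfin_def)

lemma qfin_add: "qfin x (m + n) = qfin x m * qfin (x * Q ^ m) n"
  by (induction n) (simp_all add: qfin_Suc power_add mult_ac)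

lemma qfin_Suc': "qfin x (Suc n) = (1 - x) * qfin (x * Q) n"
  using qfin_add[of x 1 n] by (simp add: qfin_Suc)

lemma qfin_zero_left [simp]: "qfin 0 n = 1"
  by (simp add: qfin_def)

lemma qinf_abs_convergent: "abs_convergent_prod (\<lambda>j. 1 - x * Q ^ j)"
proof -
  have "summable (\<lambda>j. norm (1 - x * Q ^ j - 1))"
    using summable_mult[OF summable_q_pow, of "norm x"] by (simp add: norm_mult norm_power)
  then show ?thesis
    by (simp add: abs_convergent_prod_conv_summable)
qed

lemma qinf_convergent: "convergent_prod (\<lambda>j. 1 - x * Q ^ j)"
  by (rule abs_convergent_prod_imp_convergent_prod[OF qinf_abs_convergent])

lemma qfin_tendsto: "(\<lambda>n. qfin x n) \<longlonglongrightarrow> qinf x"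
proof -
  have "(\<lambda>n. \<Prod>j\<le>n. 1 - x * Q ^ j) \<longlonglongrightarrow> qinf x"
    unfolding qinf_def by (rule convergent_prod_LIMSEQ[OF qinf_convergent])
  then have "(\<lambda>n. qfin x (Suc n)) \<longlonglongrightarrow> qinf x"
    by (simp add: qfin_def lessThan_Suc_atMost)
  then show ?thesis by (rule LIMSEQ_imp_Suc)
qed

lemma qinf_split: "qinf x = qfin x n * qinf (x * Q ^ n)"
proof -
  have "(\<lambda>m. qfin x (m + n)) \<longlonglongrightarrow> qinf x"
    by (rule LIMSEQ_ignore_initial_segment[OF qfin_tendsto])
  moreover have "(\<lambda>m. qfin x (m + n)) \<longlonglongrightarrow> qfin x n * qinf (x * Q ^ n)"
    unfolding add.commute[of _ n] qfin_add by (intro tendsto_intros qfin_tendsto)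
  ultimately show ?thesis by (rule LIMSEQ_unique)
qed

lemma qinf_step: "qinf x = (1 - x) * qinf (x * Q)"
  using qinf_split[of x 1] by (simp add: qfin_Suc)

lemma qinf_zero_left [simp]: "qinf 0 = 1"
  by (simp add: qinf_def)

lemma qinf_one [simp]: "qinf 1 = 0"
  by (subst qinf_step) simp

lemma qinf_eq_0_iff: "qinf x = 0 \<longleftrightarrow> (\<exists>n. x * Q ^ n = 1)"
proof -
  have "(\<lambda>j. 1 - x * Q ^ j) has_prod qinf x"
    unfolding qinf_def by (rule convergent_prod_has_prod[OF qinf_convergent])
  then have "qinf x = 0 \<longleftrightarrow> 0 \<in> range (\<lambda>j. 1 - x * Q ^ j)"
    by (rule has_prod_eq_0_iff)
  also have "\<dots> \<longleftrightarrow> (\<exists>n. x * Q ^ n = 1)"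
    by (auto simp: image_iff)
  finally show ?thesis .
qed

lemma qfin_nz: "qinf x \<noteq> 0 \<Longrightarrow> qfin x n \<noteq> 0"
  by (metis qinf_split mult_zero_left)

lemma qinf_shift_nz: "qinf x \<noteq> 0 \<Longrightarrow> qinf (x * Q ^ n) \<noteq> 0"
  by (metis qinf_split mult_zero_right)

lemma qinf_factor_nz: "qinf x \<noteq> 0 \<Longrightarrow> 1 - x * Q ^ n \<noteq> 0"
  by (auto simp: qinf_eq_0_iff)

lemma qinf_nz_of_norm: "norm x < 1 \<Longrightarrow> qinf x \<noteq> 0"
proof
  assume x: "norm x < 1" and "qinf x = 0"
  then obtain n where "x * Q ^ n = 1" by (auto simp: qinf_eq_0_iff)
  then have "norm x * q ^ n = 1" by (metis norm_mult norm_Q_pow norm_one)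
  moreover have "norm x * q ^ n \<le> norm x"
    using q_pow_le_1 by (simp add: mult_left_le)
  ultimately show False using x by simp
qed

lemma qinf_Q_nz [simp]: "qinf Q \<noteq> 0"
  using q_less_1 by (intro qinf_nz_of_norm) simp

lemma qfin_Q_nz [simp]: "qfin Q n \<noteq> 0"
  by (rule qfin_nz) simp

lemma qinf_divide_shift: "qinf x \<noteq> 0 \<Longrightarrow> qinf (x * Q ^ n) = qinf x / qfin x n"
  using qfin_nz[of x n] qinf_split[of x n] by (simp add: field_simps)

lemma norm_qfin_le:
  assumes "norm x \<le> r"
  shows "norm (qfin x n) \<le> exp (r / (1 - q))"
proof -
  have "norm (qfin x n) = (\<Prod>j<n. norm (1 - x * Q ^ j))"
    by (simp add: qfin_def prod_norm)
  also have "\<dots> \<le> (\<Prod>j<n. 1 + r * q ^ j)"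
  proof (intro prod_mono conjI)
    fix j
    have "norm (1 - x * Q ^ j) \<le> 1 + norm x * q ^ j"
      by (metis norm_triangle_ineq4 norm_one norm_mult norm_Q_pow)
    also have "\<dots> \<le> 1 + r * q ^ j"
      using assms q_pos by (simp add: mult_right_mono)
    finally show "norm (1 - x * Q ^ j) \<le> 1 + r * q ^ j" .
  qed auto
  also have "\<dots> \<le> exp (\<Sum>j<n. r * q ^ j)"
    using assms q_pos norm_ge_zero[of x] by (intro prod_le_exp_sum) (meson mult_nonneg_nonneg order_trans zero_le_power less_imp_le)
  also have "(\<Sum>j<n. r * q ^ j) \<le> r / (1 - q)"
  proof -
    have r: "0 \<le> r" using assms norm_ge_zero[of x] by linarith
    have "(\<Sum>j<n. q ^ j) \<le> (\<Sum>j. q ^ j)"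
      using q_pos by (intro sum_le_suminf summable_q_pow) auto
    also have "\<dots> = 1 / (1 - q)"
      using q_pos q_less_1 by (intro suminf_geometric) auto
    finally have "r * (\<Sum>j<n. q ^ j) \<le> r * (1 / (1 - q))"
      using r by (rule mult_left_mono)
    then show ?thesis by (simp add: sum_distrib_left)
  qed
  finally show ?thesis by simp
qed

lemma norm_qinf_le:
  assumes "norm x \<le> r"
  shows "norm (qinf x) \<le> exp (r / (1 - q))"
  by (rule LIMSEQ_le_const2[OF tendsto_norm[OF qfin_tendsto]]) (use norm_qfin_le[OF assms] in auto)

lemma inverse_qfin_bounded:
  assumes "qinf x \<noteq> 0"
  shows "\<exists>C>0. \<forall>n. norm (inverse (qfin x n)) \<le> C"
proof -
  have "(\<lambda>n. inverse (qfin x n)) \<longlonglongrightarrow> inverse (qinf x)"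
    using assms by (intro tendsto_inverse qfin_tendsto)
  then have "Bseq (\<lambda>n. inverse (qfin x n))"
    by (intro convergent_imp_Bseq convergentI)
  then show ?thesis by (auto simp: Bseq_def)
qed

lemma qfin_holomorphic: "(\<lambda>x. qfin x n) holomorphic_on A"
  unfolding qfin_def by (intro holomorphic_intros)

lemma uniform_limit_qfin: "uniform_limit (cball 0 r) (\<lambda>n x. qfin x n) qinf sequentially"
proof -
  have uc: "uniformly_convergent_on (cball 0 r) (\<lambda>n x. \<Prod>j<n. 1 + - x * Q ^ j)"
  proof (rule uniformly_convergent_on_prod)
    show "continuous_on (cball 0 r) (\<lambda>x. - x * Q ^ n)" for n
      by (intro continuous_intros)
    show "compact (cball (0::complex) r)" by simp
    show "uniformly_convergent_on (cball 0 r) (\<lambda>n x. \<Sum>j<n. norm (- x * Q ^ j))"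
    proof (rule Weierstrass_m_test'_ev[where M = "\<lambda>j. r * q ^ j"])
      show "\<forall>\<^sub>F j in sequentially. \<forall>x\<in>cball 0 r. norm (norm (- x * Q ^ j)) \<le> r * q ^ j"
        using q_pos by (intro always_eventually) (auto simp: norm_mult norm_power mult_right_mono)
      show "summable (\<lambda>j. r * q ^ j)"
        by (intro summable_mult summable_q_pow)
    qed
  qed
  then have "uniform_limit (cball 0 r) (\<lambda>n x. qfin x n) (\<lambda>x. lim (\<lambda>n. qfin x n)) sequentially"
    unfolding qfin_def by (simp add: uniformly_convergent_uniform_limit_iff)
  moreover have "(\<lambda>x. lim (\<lambda>n. qfin x n)) = qinf"
    using limI[OF qfin_tendsto] by auto
  ultimately show ?thesis by simp
qed

lemma qinf_holomorphic: "qinf holomorphic_on A"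
proof -
  have "qinf holomorphic_on UNIV"
  proof (rule holomorphic_uniform_sequence[where f = "\<lambda>n x. qfin x n"])
    fix x :: complex
    have "uniform_limit (cball x 1) (\<lambda>n x. qfin x n) qinf sequentially"
      by (rule uniform_limit_on_subset[OF uniform_limit_qfin[of "norm x + 1"]])
         (auto simp: dist_norm, metis add.commute norm_minus_commute norm_triangle_sub order_trans add_left_mono)
    then show "\<exists>d>0. cball x d \<subseteq> UNIV \<and> uniform_limit (cball x d) (\<lambda>n x. qfin x n) qinf sequentially"
      by (intro exI[of _ 1]) auto
  qed (auto intro: qfin_holomorphic)
  then show ?thesis by (rule holomorphic_on_subset) auto
qed

lemma qinf_tendsto: "(f \<longlongrightarrow> x) F \<Longrightarrow> ((\<lambda>y. qinf (f y)) \<longlongrightarrow> qinf x) F"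
  by (rule isCont_tendsto_compose[of x qinf])
     (meson UNIV_I continuous_on_eq_continuous_at holomorphic_on_imp_continuous_on open_UNIV qinf_holomorphic)

lemma qinf_Q_pow_tendsto: "(\<lambda>n. qinf (x * Q ^ n)) \<longlonglongrightarrow> 1"
  using qinf_tendsto[OF tendsto_mult_left[OF Q_pow_tendsto_0, of x]] by simp

section \<open>The nonterminating very-well-poised 6-phi-5 sum\<close>

text \<open>
  This is \<open>(1/t; q)\<^sub>k t\<^sup>k\<close>, written as a polynomial in \<open>t\<close> so that \<open>t = 0\<close> is an ordinary point.
\<close>

definition node_poly :: "complex \<Rightarrow> nat \<Rightarrow> complex" where
  "node_poly t k = (\<Prod>i<k. t - Q ^ i)"

text \<open>
  With \<open>\<alpha>q = ubc\<close>, i.e. \<open>u = \<alpha>q/(bc)\<close>, the entries \<open>ub\<close> and \<open>uc\<close> are the usual \<open>\<alpha>q/c\<close> and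
  \<open>\<alpha>q/b\<close>. The parametrization by \<open>u\<close> turns the relation behind the telescoping into a polynomial
  identity.
\<close>

definition vwp_coeff :: "complex \<Rightarrow> complex \<Rightarrow> complex \<Rightarrow> complex \<Rightarrow> nat \<Rightarrow> complex" where
  "vwp_coeff \<alpha> b c u k =
     (1 - \<alpha> * Q ^ (2 * k)) / (1 - \<alpha>) * (qfin \<alpha> k * qfin b k * qfin c k)
     / (qfin Q k * qfin (u * b) k * qfin (u * c) k) * u ^ k"

text \<open>
  The \<open>6\<phi>5\<close> summand with parameters \<open>\<alpha>, b, c, 1/t\<close>, multiplied by \<open>(\<alpha>qt; q)\<^sub>\<infinity>\<close>: this clears the
  denominator \<open>(\<alpha>qt; q)\<^sub>k\<close> and leaves each summand entire in \<open>t\<close>.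
\<close>

definition vwp_term :: "complex \<Rightarrow> complex \<Rightarrow> complex \<Rightarrow> complex \<Rightarrow> complex \<Rightarrow> nat \<Rightarrow> complex" where
  "vwp_term \<alpha> b c u t k = vwp_coeff \<alpha> b c u k * node_poly t k * qinf (\<alpha> * Q ^ Suc k * t)"

definition vwp_sum :: "complex \<Rightarrow> complex \<Rightarrow> complex \<Rightarrow> complex \<Rightarrow> complex \<Rightarrow> complex" where
  "vwp_sum \<alpha> b c u t = (\<Sum>k. vwp_term \<alpha> b c u t k)"

text \<open>
  The partial sums, in closed form, of the q-difference equation applied to \<open>vwp_term\<close> termwise.
\<close>

definition vwp_cert :: "complex \<Rightarrow> complex \<Rightarrow> complex \<Rightarrow> complex \<Rightarrow> complex \<Rightarrow> nat \<Rightarrow> complex" where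
  "vwp_cert \<alpha> b c u t k =
     - t * u ^ Suc k * (qfin (\<alpha> * Q) k * qfin b (Suc k) * qfin c (Suc k))
       / (qfin Q k * qfin (u * b) k * qfin (u * c) k)
     * node_poly t k * qinf (\<alpha> * Q ^ (k + 2) * t)"

lemma node_poly_0 [simp]: "node_poly t 0 = 1"
  by (simp add: node_poly_def)

lemma node_poly_Suc: "node_poly t (Suc k) = node_poly t k * (t - Q ^ k)"
  by (simp add: node_poly_def)

lemma node_poly_shift: "node_poly (t * Q) (Suc k) = (t * Q - 1) * Q ^ k * node_poly t k"
proof -
  have "node_poly (t * Q) (Suc k) = (t * Q - 1) * (\<Prod>i<k. (t - Q ^ i) * Q)"
    unfolding node_poly_def by (subst prod.lessThan_Suc_shift) (simp add: algebra_simps)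
  then show ?thesis by (simp add: node_poly_def prod.distrib)
qed

lemma node_poly_Q_pow: "m < k \<Longrightarrow> node_poly (Q ^ m) k = 0"
  by (auto simp: node_poly_def)

text \<open>
  The product is at most \<open>\<Prod>i<k. (r + q\<^sup>i) = r\<^sup>k * (\<Prod>i<k. (1 + q\<^sup>i/r))\<close>, and the last factor is bounded in \<open>k\<close>.
\<close>

lemma norm_node_poly_le:
  assumes "norm t \<le> r" "0 < r"
  shows "norm (node_poly t k) \<le> exp ((1 / r) / (1 - q)) * r ^ k"
proof -
  have "norm (node_poly t k) = (\<Prod>i<k. norm (t - Q ^ i))"
    by (simp add: node_poly_def prod_norm)
  also have "\<dots> \<le> (\<Prod>i<k. r + q ^ i)"
    using assms by (intro prod_mono conjI) (auto intro: order_trans[OF norm_triangle_ineq4] simp: norm_power)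
  also have "\<dots> = (\<Prod>i<k. norm (1 - of_real (- 1 / r) * Q ^ i)) * r ^ k"
  proof -
    have "norm (1 - of_real (- 1 / r) * Q ^ i) * r = r + q ^ i" for i
    proof -
      have "1 - of_real (- 1 / r) * Q ^ i = complex_of_real (1 + q ^ i / r)" by simp
      then have "norm (1 - of_real (- 1 / r) * Q ^ i) = 1 + q ^ i / r"
        using assms q_pos by (metis abs_of_nonneg add_nonneg_nonneg divide_nonneg_pos less_imp_le norm_of_real zero_le_one zero_le_power)
      then show ?thesis using assms by (simp add: field_simps)
    qed
    then have "(\<Prod>i<k. r + q ^ i) = (\<Prod>i<k. norm (1 - of_real (- 1 / r) * Q ^ i) * r)"
      by simp
    then show ?thesis by (simp only: prod.distrib) simp
  qed
  also have "(\<Prod>i<k. norm (1 - of_real (- 1 / r) * Q ^ i)) \<le> exp ((1 / r) / (1 - q))"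
    unfolding prod_norm qfin_def[symmetric] by (rule norm_qfin_le) (use assms in \<open>simp add: norm_divide\<close>)
  finally show ?thesis using assms by (simp add: mult_right_mono)
qed

text \<open>
  Either the series converges geometrically, or \<open>1/t = q\<^bsup>-m\<^esup>\<close> and it terminates.
\<close>

definition admissible :: "complex \<Rightarrow> complex \<Rightarrow> bool" where
  "admissible u t \<longleftrightarrow> norm (u * t) < 1 \<or> (\<exists>m. t = Q ^ m)"

lemma vwp_coeff_Suc:
  assumes "\<alpha> \<noteq> 1"
  shows "vwp_coeff \<alpha> b c u (Suc k) =
    (1 - \<alpha> * Q ^ (2 * Suc k)) * (qfin (\<alpha> * Q) k * qfin b (Suc k) * qfin c (Suc k))
     / (qfin Q (Suc k) * qfin (u * b) (Suc k) * qfin (u * c) (Suc k)) * u ^ Suc k"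
  using assms unfolding vwp_coeff_def qfin_Suc'[of \<alpha>] by simp

context
  fixes \<alpha> b c u :: complex
  assumes well_poised: "\<alpha> * Q = u * b * c"
    and alpha: "\<alpha> \<noteq> 1"
    and nz: "qinf (u * b) \<noteq> 0" "qinf (u * c) \<noteq> 0"
begin

lemma vwp_telescope_0:
  "(1 - u * t) * vwp_term \<alpha> b c u t 0
     - (1 - u * b * t) * (1 - u * c * t) * vwp_term \<alpha> b c u (t * Q) 0 = vwp_cert \<alpha> b c u t 0"
proof -
  have 1: "qinf (\<alpha> * Q * t) = (1 - u * b * c * t) * qinf (\<alpha> * Q ^ 2 * t)"
    using qinf_step[of "\<alpha> * Q * t"] unfolding well_poised[symmetric]
    by (simp add: power2_eq_square mult_ac)
  have e1: "vwp_term \<alpha> b c u t 0 = (1 - u * b * c * t) * qinf (\<alpha> * Q ^ 2 * t)"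
    using alpha by (simp add: vwp_term_def vwp_coeff_def 1)
  have eq: "\<alpha> * Q ^ Suc 0 * (t * Q) = \<alpha> * Q ^ 2 * t"
    by (simp add: power2_eq_square)
  have e2: "vwp_term \<alpha> b c u (t * Q) 0 = qinf (\<alpha> * Q ^ 2 * t)"
    using alpha unfolding vwp_term_def eq by (simp add: vwp_coeff_def)
  have h: "vwp_cert \<alpha> b c u t 0 = - t * u * ((1 - b) * (1 - c)) * qinf (\<alpha> * Q ^ 2 * t)"
    by (simp add: vwp_cert_def qfin_Suc power2_eq_square)
  show ?thesis unfolding e1 e2 h by algebra
qed

lemma vwp_telescope_Suc:
  "(1 - u * t) * vwp_term \<alpha> b c u t (Suc k)
     - (1 - u * b * t) * (1 - u * c * t) * vwp_term \<alpha> b c u (t * Q) (Suc k)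
   = vwp_cert \<alpha> b c u t (Suc k) - vwp_cert \<alpha> b c u t k"
proof -
  define x where "x = Q ^ k"
  \<comment> \<open>The common factor of the four terms; what remains is a polynomial identity in \<open>x = q\<^sup>k\<close>.\<close>
  define F where "F = u ^ Suc k * (qfin (\<alpha> * Q) k * qfin b (Suc k) * qfin c (Suc k))
     / (qfin Q (Suc k) * qfin (u * b) (Suc k) * qfin (u * c) (Suc k))
     * node_poly t k * qinf (\<alpha> * Q ^ (k + 3) * t)"
  have nz': "1 - Q * x \<noteq> 0" "1 - u * b * x \<noteq> 0" "1 - u * c * x \<noteq> 0"
    using qinf_factor_nz[of Q k] qinf_factor_nz[OF nz(1), of k] qinf_factor_nz[OF nz(2), of k]
    by (auto simp: x_def)
  have aQ: "\<alpha> * Q ^ (k + 2) = u * b * c * Q * x"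
    using well_poised by (simp add: x_def power_add power2_eq_square)
  have P2: "qinf (\<alpha> * Q ^ (k + 2) * t) = (1 - u * b * c * Q * x * t) * qinf (\<alpha> * Q ^ (k + 3) * t)"
    using qinf_step[of "\<alpha> * Q ^ (k + 2) * t"] unfolding aQ[symmetric]
    by (simp add: power_add power2_eq_square power3_eq_cube mult_ac)
  have a2: "\<alpha> * Q ^ (2 * Suc k) = u * b * c * Q * x ^ 2"
    using well_poised by (simp add: x_def power_add power2_eq_square mult_2)
  have a1: "\<alpha> * Q * Q ^ k = u * b * c * x"
    using well_poised by (simp add: x_def)
  have e1: "vwp_term \<alpha> b c u t (Suc k) =
      F * ((1 - u * b * c * Q * x ^ 2) * (t - x) * (1 - u * b * c * Q * x * t))"
    unfolding vwp_term_def vwp_coeff_Suc[OF alpha] F_def a2 node_poly_Suc x_def[symmetric]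
    using P2 by (simp add: mult_ac)
  have e2: "vwp_term \<alpha> b c u (t * Q) (Suc k) =
      F * ((1 - u * b * c * Q * x ^ 2) * ((t * Q - 1) * x))"
  proof -
    have eq: "\<alpha> * Q ^ Suc (Suc k) * (t * Q) = \<alpha> * Q ^ (k + 3) * t"
      by (simp add: power_add power3_eq_cube)
    show ?thesis
      unfolding vwp_term_def eq vwp_coeff_Suc[OF alpha] F_def a2 node_poly_shift
      unfolding x_def[symmetric]
      by (simp add: mult_ac)
  qed
  have h1: "vwp_cert \<alpha> b c u t k =
      - t * F * ((1 - Q * x) * (1 - u * b * x) * (1 - u * c * x) * (1 - u * b * c * Q * x * t))"
    unfolding vwp_cert_def F_def P2 qfin_Suc[of Q k] qfin_Suc[of "u * b" k] qfin_Suc[of "u * c" k]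
      x_def[symmetric]
    using nz' by (simp add: ac_simps)
  have h2: "vwp_cert \<alpha> b c u t (Suc k) =
      - t * F * (u * (1 - u * b * c * x) * (1 - b * Q * x) * (1 - c * Q * x) * (t - x))"
  proof -
    have "qfin (\<alpha> * Q) (Suc k) = qfin (\<alpha> * Q) k * (1 - u * b * c * x)"
      by (simp only: qfin_Suc a1)
    moreover have "qfin b (Suc (Suc k)) = qfin b (Suc k) * (1 - b * Q * x)"
      "qfin c (Suc (Suc k)) = qfin c (Suc k) * (1 - c * Q * x)"
      by (simp_all add: qfin_Suc[of _ "Suc k"] x_def)
    moreover have eq: "\<alpha> * Q ^ (Suc k + 2) * t = \<alpha> * Q ^ (k + 3) * t"
      by (simp add: numeral_3_eq_3)
    ultimately show ?thesis
      unfolding vwp_cert_def eq F_def node_poly_Suc x_def[symmetric] by (simp add: mult_ac)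
  qed
  show ?thesis unfolding e1 e2 h1 h2 by algebra
qed

lemma vwp_telescope:
  "(\<Sum>k<Suc n. (1 - u * t) * vwp_term \<alpha> b c u t k
     - (1 - u * b * t) * (1 - u * c * t) * vwp_term \<alpha> b c u (t * Q) k) = vwp_cert \<alpha> b c u t n"
proof (induction n)
  case 0
  show ?case using vwp_telescope_0 by simp
next
  case (Suc n)
  show ?case
    by (subst sum.lessThan_Suc, subst Suc.IH, subst vwp_telescope_Suc) simp
qed

lemma vwp_coeff_bound: "\<exists>C>0. \<forall>k. norm (vwp_coeff \<alpha> b c u k) \<le> C * norm u ^ k"
proof -
  obtain C1 where C1: "C1 > 0" "\<And>n. norm (inverse (qfin Q n)) \<le> C1"
    using inverse_qfin_bounded[OF qinf_Q_nz] by auto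
  obtain C2 where C2: "C2 > 0" "\<And>n. norm (inverse (qfin (u * b) n)) \<le> C2"
    using inverse_qfin_bounded[OF nz(1)] by auto
  obtain C3 where C3: "C3 > 0" "\<And>n. norm (inverse (qfin (u * c) n)) \<le> C3"
    using inverse_qfin_bounded[OF nz(2)] by auto
  define M where "M x = exp (norm x / (1 - q))" for x :: complex
  have M: "norm (qfin x n) \<le> M x" "0 < M x" for x n
    using norm_qfin_le[of x "norm x" n] by (auto simp: M_def)
  define C where "C = (1 + norm \<alpha>) / norm (1 - \<alpha>) * (M \<alpha> * M b * M c) * (C1 * C2 * C3)"
  have "norm (vwp_coeff \<alpha> b c u k) \<le> C * norm u ^ k" for k
  proof -
    have "norm (1 - \<alpha> * Q ^ (2 * k)) \<le> 1 + norm \<alpha> * 1"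
      by (rule order_trans[OF norm_triangle_ineq4])
         (use q_pow_le_1[of "2 * k"] in \<open>auto simp: norm_mult norm_power intro!: mult_left_le\<close>)
    then have 1: "norm ((1 - \<alpha> * Q ^ (2 * k)) / (1 - \<alpha>)) \<le> (1 + norm \<alpha>) / norm (1 - \<alpha>)"
      by (simp add: norm_divide divide_right_mono)
    have "vwp_coeff \<alpha> b c u k = (1 - \<alpha> * Q ^ (2 * k)) / (1 - \<alpha>) * (qfin \<alpha> k * qfin b k * qfin c k)
       * (inverse (qfin Q k) * inverse (qfin (u * b) k) * inverse (qfin (u * c) k)) * u ^ k"
      by (simp add: vwp_coeff_def divide_inverse)
    also have "norm \<dots> = norm ((1 - \<alpha> * Q ^ (2 * k)) / (1 - \<alpha>))
       * (norm (qfin \<alpha> k) * norm (qfin b k) * norm (qfin c k))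
       * (norm (inverse (qfin Q k)) * norm (inverse (qfin (u * b) k)) * norm (inverse (qfin (u * c) k)))
       * norm u ^ k"
      by (simp only: norm_mult norm_power)
    also have "\<dots> \<le> C * norm u ^ k"
      unfolding C_def
      by (intro mult_right_mono mult_mono 1 M C1 C2 C3 mult_nonneg_nonneg less_imp_le[OF M(2)]
            less_imp_le[OF C1(1)] less_imp_le[OF C2(1)] less_imp_le[OF C3(1)]
            divide_nonneg_nonneg add_nonneg_nonneg norm_ge_zero zero_le_power zero_le_one)
    finally show ?thesis .
  qed
  moreover have "C > 0"
    unfolding C_def using alpha C1(1) C2(1) C3(1) M(2)
    by (intro mult_pos_pos divide_pos_pos add_pos_nonneg) auto
  ultimately show ?thesis by blast
qed

lemma vwp_term_bound:
  assumes "r > 0"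
  shows "\<exists>C>0. \<forall>t k. norm t \<le> r \<longrightarrow> norm (vwp_term \<alpha> b c u t k) \<le> C * (norm u * r) ^ k"
proof -
  obtain C where C: "C > 0" "\<And>k. norm (vwp_coeff \<alpha> b c u k) \<le> C * norm u ^ k"
    using vwp_coeff_bound by auto
  define D where "D = exp ((1 / r) / (1 - q))"
  define M where "M = exp (norm \<alpha> * r / (1 - q))"
  have "norm (vwp_term \<alpha> b c u t k) \<le> (C * D * M) * (norm u * r) ^ k" if t: "norm t \<le> r" for t k
  proof -
    have "norm (\<alpha> * Q ^ Suc k * t) = norm \<alpha> * q ^ Suc k * norm t"
      by (simp add: norm_mult norm_power)
    also have "\<dots> \<le> norm \<alpha> * 1 * r"
      using t assms q_pos by (intro mult_mono q_pow_le_1) auto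
    finally have 1: "norm (qinf (\<alpha> * Q ^ Suc k * t)) \<le> M"
      unfolding M_def by (intro norm_qinf_le) simp
    have 2: "norm (node_poly t k) \<le> D * r ^ k"
      unfolding D_def by (rule norm_node_poly_le[OF t assms])
    have "norm (vwp_term \<alpha> b c u t k) =
        norm (vwp_coeff \<alpha> b c u k) * norm (node_poly t k) * norm (qinf (\<alpha> * Q ^ Suc k * t))"
      by (simp add: vwp_term_def norm_mult)
    also have "\<dots> \<le> (C * norm u ^ k) * (D * r ^ k) * M"
      using C(1) assms by (intro mult_mono C(2) 1 2) (auto simp: D_def)
    finally show ?thesis by (simp add: power_mult_distrib mult_ac)
  qed
  moreover have "C * D * M > 0" using C(1) by (simp add: D_def M_def)
  ultimately show ?thesis by blast
qed

lemma admissible_shift: "admissible u t \<Longrightarrow> admissible u (t * Q)"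
proof -
  have "norm (u * (t * Q)) \<le> norm (u * t)"
    using q_less_1 q_pos by (simp add: norm_mult mult_left_le mult_left_mono)
  moreover have "Q ^ m * Q = Q ^ Suc m" for m by simp
  ultimately show "admissible u t \<Longrightarrow> admissible u (t * Q)"
    unfolding admissible_def by (metis order_le_less_trans)
qed

lemma geometric_radius:
  assumes "norm (u * t) < 1"
  obtains r where "r > 0" "norm t \<le> r" "norm u * r < 1"
proof (cases "u = 0")
  case True
  show ?thesis by (rule that[of "norm t + 1"]) (use True norm_ge_zero[of t] in \<open>simp_all add: add_nonneg_pos\<close>)
next
  case False
  have "norm t < 1 / norm u"
    using assms False by (simp add: norm_mult field_simps)
  then obtain r where "norm t < r" "r < 1 / norm u" using dense by blast
  then show ?thesis using False
    by (intro that[of r]) (auto simp: field_simps intro: le_less_trans[OF norm_ge_zero])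
qed

lemma vwp_term_summable:
  assumes "admissible u t"
  shows "summable (vwp_term \<alpha> b c u t)"
  using assms unfolding admissible_def
proof
  assume "norm (u * t) < 1"
  then obtain r where r: "r > 0" "norm t \<le> r" "norm u * r < 1" by (rule geometric_radius)
  then obtain C where C: "\<And>k. norm (vwp_term \<alpha> b c u t k) \<le> C * (norm u * r) ^ k"
    using vwp_term_bound[OF r(1)] by blast
  show ?thesis
    by (rule summable_comparison_test'[where N = 0 and g = "\<lambda>k. C * (norm u * r) ^ k"])
       (use C r in \<open>auto intro!: summable_mult summable_geometric\<close>)
next
  assume "\<exists>m. t = Q ^ m"
  then obtain m where "t = Q ^ m" ..
  then show ?thesis
    by (intro summable_finite[of "{..m}"]) (auto simp: vwp_term_def node_poly_Q_pow)
qed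

lemma vwp_cert_tendsto_0:
  assumes "admissible u t"
  shows "vwp_cert \<alpha> b c u t \<longlonglongrightarrow> 0"
proof -
  have lim: "(\<lambda>k. t * u * (qfin (\<alpha> * Q) k * qfin b (Suc k) * qfin c (Suc k))
       / (qfin Q k * qfin (u * b) k * qfin (u * c) k) * qinf (\<alpha> * Q ^ 2 * t * Q ^ k))
      \<longlonglongrightarrow> t * u * (qinf (\<alpha> * Q) * qinf b * qinf c) / (qinf Q * qinf (u * b) * qinf (u * c)) * 1"
    using nz by (intro tendsto_intros qfin_tendsto LIMSEQ_Suc qinf_Q_pow_tendsto) auto
  have "(\<lambda>k. u ^ k * node_poly t k) \<longlonglongrightarrow> 0"
    using assms unfolding admissible_def
  proof
    assume "norm (u * t) < 1"
    then obtain r where r: "r > 0" "norm t \<le> r" "norm u * r < 1" by (rule geometric_radius)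
    show ?thesis
    proof (rule Lim_null_comparison)
      show "\<forall>\<^sub>F k in sequentially. norm (u ^ k * node_poly t k) \<le> exp ((1 / r) / (1 - q)) * (norm u * r) ^ k"
      proof (intro always_eventually allI)
        fix k
        have "norm u ^ k * norm (node_poly t k) \<le> norm u ^ k * (exp ((1 / r) / (1 - q)) * r ^ k)"
          by (intro mult_left_mono norm_node_poly_le r) auto
        then show "norm (u ^ k * node_poly t k) \<le> exp ((1 / r) / (1 - q)) * (norm u * r) ^ k"
          by (simp add: norm_mult norm_power power_mult_distrib mult_ac)
      qed
      show "(\<lambda>k. exp ((1 / r) / (1 - q)) * (norm u * r) ^ k) \<longlonglongrightarrow> 0"
        using r by (intro tendsto_mult_right_zero LIMSEQ_realpow_zero) auto
    qed
  next
    assume "\<exists>m. t = Q ^ m"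
    then obtain m where "t = Q ^ m" ..
    then show ?thesis
      by (intro tendsto_eventually eventually_sequentiallyI[of "Suc m"]) (simp add: node_poly_Q_pow)
  qed
  from tendsto_mult[OF lim this] have "(\<lambda>k. - (t * u * (qfin (\<alpha> * Q) k * qfin b (Suc k) * qfin c (Suc k))
       / (qfin Q k * qfin (u * b) k * qfin (u * c) k) * qinf (\<alpha> * Q ^ 2 * t * Q ^ k)
       * (u ^ k * node_poly t k))) \<longlonglongrightarrow> - 0"
    by (intro tendsto_minus) simp
  moreover have "vwp_cert \<alpha> b c u t = (\<lambda>k. - (t * u * (qfin (\<alpha> * Q) k * qfin b (Suc k) * qfin c (Suc k))
       / (qfin Q k * qfin (u * b) k * qfin (u * c) k) * qinf (\<alpha> * Q ^ 2 * t * Q ^ k)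
       * (u ^ k * node_poly t k)))"
  proof
    fix k
    have eq: "\<alpha> * Q ^ (k + 2) * t = \<alpha> * Q ^ 2 * t * Q ^ k" by (simp add: power_add power2_eq_square)
    show "vwp_cert \<alpha> b c u t k = - (t * u * (qfin (\<alpha> * Q) k * qfin b (Suc k) * qfin c (Suc k))
       / (qfin Q k * qfin (u * b) k * qfin (u * c) k) * qinf (\<alpha> * Q ^ 2 * t * Q ^ k)
       * (u ^ k * node_poly t k))"
      unfolding vwp_cert_def eq by (simp add: mult_ac)
  qed
  ultimately show ?thesis by simp
qed

lemma vwp_sum_recurrence:
  assumes "admissible u t"
  shows "(1 - u * t) * vwp_sum \<alpha> b c u t
    = (1 - u * b * t) * (1 - u * c * t) * vwp_sum \<alpha> b c u (t * Q)"
proof -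
  have "(\<lambda>k. (1 - u * t) * vwp_term \<alpha> b c u t k
       - (1 - u * b * t) * (1 - u * c * t) * vwp_term \<alpha> b c u (t * Q) k)
     sums ((1 - u * t) * vwp_sum \<alpha> b c u t
       - (1 - u * b * t) * (1 - u * c * t) * vwp_sum \<alpha> b c u (t * Q))"
    unfolding vwp_sum_def
    by (intro sums_diff sums_mult summable_sums vwp_term_summable assms admissible_shift)
  moreover have "(\<lambda>k. (1 - u * t) * vwp_term \<alpha> b c u t k
       - (1 - u * b * t) * (1 - u * c * t) * vwp_term \<alpha> b c u (t * Q) k) sums 0"
    unfolding sums_def
    by (subst filterlim_sequentially_Suc[symmetric], subst vwp_telescope)
       (rule vwp_cert_tendsto_0[OF assms])
  ultimately show ?thesis by (auto dest: sums_unique2)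
qed

text \<open>
  Once \<open>\<bar>tq\<^sup>n\<bar> \<le> r\<close> for a fixed \<open>r\<close> with \<open>\<bar>u\<bar>r < 1\<close>, the terms have a common geometric majorant.
\<close>

lemma vwp_sum_tendsto: "(\<lambda>n. vwp_sum \<alpha> b c u (t * Q ^ n)) \<longlonglongrightarrow> vwp_sum \<alpha> b c u 0"
proof -
  obtain r where r: "r > 0" "norm u * r < 1"
    using geometric_radius[of 0] by auto
  obtain C where C: "\<And>t k. norm t \<le> r \<Longrightarrow> norm (vwp_term \<alpha> b c u t k) \<le> C * (norm u * r) ^ k"
    using vwp_term_bound[OF r(1)] by blast
  have t0: "(\<lambda>n. t * Q ^ n) \<longlonglongrightarrow> 0"
    by (intro tendsto_mult_right_zero Q_pow_tendsto_0)
  have "\<forall>\<^sub>F n in sequentially. norm (t * Q ^ n) < r"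
    using order_tendstoD(2)[OF tendsto_norm[OF t0]] r(1) by simp
  then have ev: "\<forall>\<^sub>F n in sequentially. norm (t * Q ^ n) \<le> r"
    by eventually_elim simp
  show ?thesis
    unfolding vwp_sum_def
  proof (rule tannerys_theorem[THEN conjunct2, THEN conjunct2])
    fix k
    show "(\<lambda>n. vwp_term \<alpha> b c u (t * Q ^ n) k) \<longlonglongrightarrow> vwp_term \<alpha> b c u 0 k"
      unfolding vwp_term_def node_poly_def by (intro tendsto_intros qinf_tendsto t0)
  next
    show "\<forall>\<^sub>F (k, n) in at_top \<times>\<^sub>F sequentially.
        norm (vwp_term \<alpha> b c u (t * Q ^ n) k) \<le> C * (norm u * r) ^ k"
      unfolding eventually_prod_filter
      by (rule exI[of _ "\<lambda>_. True"], rule exI[of _ "\<lambda>n. norm (t * Q ^ n) \<le> r"]) (use ev C in auto)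
  qed (use r in \<open>auto intro!: summable_mult summable_geometric\<close>)
qed

text \<open>
  At \<open>t = 1\<close> only the summand \<open>k = 0\<close> survives; the q-difference equation then leads from \<open>q\<^sup>n\<close> to
  \<open>q\<^bsup>n+1\<^esup>\<close>. All these series terminate, whatever the size of \<open>u\<close>.
\<close>

lemma vwp_sum_Q_pow:
  "vwp_sum \<alpha> b c u (Q ^ n) = qinf (\<alpha> * Q) * qfin u n / (qfin (u * b) n * qfin (u * c) n)"
proof (induction n)
  case 0
  have "vwp_sum \<alpha> b c u 1 = (\<Sum>k\<in>{0}. vwp_term \<alpha> b c u 1 k)"
    unfolding vwp_sum_def
    by (intro suminf_finite) (use node_poly_Q_pow[of 0] in \<open>auto simp: vwp_term_def\<close>)
  then show ?case using alpha by (simp add: vwp_term_def vwp_coeff_def)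
next
  case (Suc n)
  have "(1 - u * Q ^ n) * vwp_sum \<alpha> b c u (Q ^ n)
      = (1 - u * b * Q ^ n) * (1 - u * c * Q ^ n) * vwp_sum \<alpha> b c u (Q ^ Suc n)"
    using vwp_sum_recurrence[of "Q ^ n"] by (auto simp: admissible_def mult_ac)
  then have "vwp_sum \<alpha> b c u (Q ^ Suc n) = (1 - u * Q ^ n) * vwp_sum \<alpha> b c u (Q ^ n)
      / ((1 - u * b * Q ^ n) * (1 - u * c * Q ^ n))"
    using qinf_factor_nz[OF nz(1), of n] qinf_factor_nz[OF nz(2), of n]
    by (simp add: eq_divide_eq mult_ac)
  then show ?case
    unfolding Suc.IH qfin_Suc by (simp add: mult_ac)
qed

text \<open>
  The points \<open>q\<^sup>n\<close> accumulate at \<open>0\<close>, so the terminating evaluations determine the value there.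
\<close>

lemma vwp_sum_0:
  "vwp_sum \<alpha> b c u 0 = qinf (\<alpha> * Q) * qinf u / (qinf (u * b) * qinf (u * c))"
proof (rule LIMSEQ_unique)
  show "(\<lambda>n. vwp_sum \<alpha> b c u (Q ^ n)) \<longlonglongrightarrow> vwp_sum \<alpha> b c u 0"
    using vwp_sum_tendsto[of 1] by simp
  show "(\<lambda>n. vwp_sum \<alpha> b c u (Q ^ n)) \<longlonglongrightarrow> qinf (\<alpha> * Q) * qinf u / (qinf (u * b) * qinf (u * c))"
    unfolding vwp_sum_Q_pow using nz by (intro tendsto_intros qfin_tendsto) auto
qed

text \<open>
  Iterating the q-difference equation along \<open>tq\<^sup>n\<close> reduces a general \<open>t\<close> to the value at \<open>0\<close>.
\<close>

lemma vwp_sum_eq: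
  assumes t: "norm (u * t) < 1"
  shows "vwp_sum \<alpha> b c u t = qinf (\<alpha> * Q) * qinf u * qinf (u * b * t) * qinf (u * c * t)
    / (qinf (u * b) * qinf (u * c) * qinf (u * t))"
proof -
  have adm: "admissible u (t * Q ^ n)" for n
  proof (induction n)
    case (Suc n)
    then show ?case using admissible_shift[of "t * Q ^ n"] by (simp add: mult_ac)
  qed (use t in \<open>simp add: admissible_def\<close>)
  have fin: "qfin (u * t) n * vwp_sum \<alpha> b c u t
      = qfin (u * b * t) n * qfin (u * c * t) n * vwp_sum \<alpha> b c u (t * Q ^ n)" for n
  proof (induction n)
    case (Suc n)
    have rec: "(1 - u * t * Q ^ n) * vwp_sum \<alpha> b c u (t * Q ^ n)
        = (1 - u * b * t * Q ^ n) * (1 - u * c * t * Q ^ n) * vwp_sum \<alpha> b c u (t * Q ^ Suc n)"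
      using vwp_sum_recurrence[OF adm[of n]] by (simp add: mult_ac)
    have "qfin (u * t) (Suc n) * vwp_sum \<alpha> b c u t
        = (1 - u * t * Q ^ n) * (qfin (u * t) n * vwp_sum \<alpha> b c u t)"
      by (simp add: qfin_Suc mult_ac)
    also have "\<dots> = (qfin (u * b * t) n * qfin (u * c * t) n)
        * ((1 - u * t * Q ^ n) * vwp_sum \<alpha> b c u (t * Q ^ n))"
      unfolding Suc.IH by (simp only: mult_ac)
    also have "\<dots> = qfin (u * b * t) (Suc n) * qfin (u * c * t) (Suc n) * vwp_sum \<alpha> b c u (t * Q ^ Suc n)"
      unfolding rec qfin_Suc by (simp only: mult_ac)
    finally show ?case .
  qed simp
  have "qinf (u * t) * vwp_sum \<alpha> b c u t = qinf (u * b * t) * qinf (u * c * t) * vwp_sum \<alpha> b c u 0"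
  proof (rule LIMSEQ_unique)
    show "(\<lambda>n. qfin (u * t) n * vwp_sum \<alpha> b c u t) \<longlonglongrightarrow> qinf (u * t) * vwp_sum \<alpha> b c u t"
      by (intro tendsto_intros qfin_tendsto)
    show "(\<lambda>n. qfin (u * t) n * vwp_sum \<alpha> b c u t)
        \<longlonglongrightarrow> qinf (u * b * t) * qinf (u * c * t) * vwp_sum \<alpha> b c u 0"
      unfolding fin by (intro tendsto_intros qfin_tendsto vwp_sum_tendsto)
  qed
  then have "vwp_sum \<alpha> b c u t = qinf (u * b * t) * qinf (u * c * t) * vwp_sum \<alpha> b c u 0 / qinf (u * t)"
    using qinf_nz_of_norm[OF t] by (simp add: eq_divide_eq mult_ac)
  then show ?thesis
    unfolding vwp_sum_0 by (simp add: mult_ac)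
qed

end

section \<open>The nonterminating q-Saalschuetz sum\<close>

lemma summable_Q_pow_mult:
  assumes "convergent X"
  shows "summable (\<lambda>j. Q ^ j * X j)"
proof -
  obtain C where C: "\<And>j. norm (X j) \<le> C"
    using convergent_imp_Bseq[OF assms] by (auto simp: Bseq_def)
  show ?thesis
    by (rule summable_comparison_test'[where N = 0 and g = "\<lambda>j. q ^ j * C"])
       (use C q_pos in \<open>auto simp: norm_mult norm_power intro!: mult_left_mono summable_mult2 summable_q_pow\<close>)
qed

lemma suminf_Q_pow_tendsto:
  assumes "\<And>j. (\<lambda>n. X j n) \<longlonglongrightarrow> Y j" and "\<And>j n. norm (X j n) \<le> C"
  shows "(\<lambda>n. \<Sum>j. Q ^ j * X j n) \<longlonglongrightarrow> (\<Sum>j. Q ^ j * Y j)"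
proof (rule tannerys_theorem[THEN conjunct2, THEN conjunct2])
  show "(\<lambda>n. Q ^ j * X j n) \<longlonglongrightarrow> Q ^ j * Y j" for j
    by (intro tendsto_intros assms)
  show "\<forall>\<^sub>F (j, n) in at_top \<times>\<^sub>F sequentially. norm (Q ^ j * X j n) \<le> q ^ j * C"
    using assms(2) q_pos by (intro always_eventually) (auto simp: norm_mult norm_power intro!: mult_left_mono)
qed (auto intro!: summable_mult2 summable_q_pow)

definition lower_term :: "complex \<Rightarrow> complex \<Rightarrow> complex \<Rightarrow> complex \<Rightarrow> complex \<Rightarrow> nat \<Rightarrow> complex" where
  "lower_term A B d e f j =
     qinf (Q * Q ^ j) * qinf (A / B * Q * Q ^ j) * qinf (A * B * d * e * f * A * Q ^ j)
     / (qinf (A * d * Q ^ j) * qinf (A * e * Q ^ j) * qinf (A * f * Q ^ j))"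

definition upper_term :: "complex \<Rightarrow> complex \<Rightarrow> complex \<Rightarrow> complex \<Rightarrow> complex \<Rightarrow> nat \<Rightarrow> complex" where
  "upper_term A B d e f j =
     qinf (B / A * Q * Q ^ j) * qinf (Q * Q ^ j) * qinf (A * B * d * e * f * B * Q ^ j)
     * (qfin (B * d) j * qfin (B * e) j * qfin (B * f) j)"

text \<open>
  Up to the factor \<open>(1 - q) / (Bd, Be, Bf; q)\<^sub>\<infinity>\<close>, this is the q-integral from \<open>A\<close> to \<open>B\<close> of
  \<open>(qt/A, qt/B, ABdeft; q)\<^sub>\<infinity> / (dt, et, ft; q)\<^sub>\<infinity>\<close>. The normalization keeps it meaningful when
  \<open>(Bd, Be, Bf; q)\<^sub>\<infinity> = 0\<close>; in the application \<open>d, e, f\<close> are \<open>az, a/z, \<gamma>A\<close> and such zeros do occur.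
\<close>

definition saal_integral :: "complex \<Rightarrow> complex \<Rightarrow> complex \<Rightarrow> complex \<Rightarrow> complex \<Rightarrow> complex" where
  "saal_integral A B d e f = B * (\<Sum>j. Q ^ j * upper_term A B d e f j)
     - A * (qinf (B * d) * qinf (B * e) * qinf (B * f)) * (\<Sum>j. Q ^ j * lower_term A B d e f j)"

lemma saal_integral_commute:
  "saal_integral A B d e f = saal_integral A B d f e" "saal_integral A B d e f = saal_integral A B f e d"
  unfolding saal_integral_def upper_term_def lower_term_def by (simp_all only: mult_ac)

text \<open>
  Both certificates are values of \<open>ABf (t/A, t/B, ABdeft; q)\<^sub>\<infinity> / (dt, et, ft; q)\<^sub>\<infinity>\<close>, up to
  normalization, at \<open>t = Bq\<^sup>n\<close> and at \<open>t = Aq\<^sup>j\<close>. The upper one is written by cases because the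
  normalization \<open>(Bf; q)\<^sub>n / (1 - Bf)\<close> is \<open>(Bfq; q)\<^bsub>n-1\<^esub>\<close> only for positive \<open>n\<close>; at \<open>n = 0\<close> the
  factor \<open>(t/B; q)\<^sub>\<infinity>\<close> vanishes.
\<close>

definition upper_cert :: "complex \<Rightarrow> complex \<Rightarrow> complex \<Rightarrow> complex \<Rightarrow> complex \<Rightarrow> nat \<Rightarrow> complex" where
  "upper_cert A B d e f n = (case n of 0 \<Rightarrow> 0 | Suc j \<Rightarrow>
     A * B * f * (qinf (B / A * Q * Q ^ j) * qinf (Q * Q ^ j) * qinf (A * B * d * e * f * Q * B * Q ^ j)
     * (qfin (B * d) (Suc j) * qfin (B * e) (Suc j) * qfin (B * f * Q) j)))"

definition lower_cert :: "complex \<Rightarrow> complex \<Rightarrow> complex \<Rightarrow> complex \<Rightarrow> complex \<Rightarrow> nat \<Rightarrow> complex" where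
  "lower_cert A B d e f j = A * B * f * (qinf (B * d) * qinf (B * e) * qinf (B * f * Q))
     * (qinf (Q ^ j) * qinf (A / B * Q ^ j) * qinf (A * B * d * e * f * A * Q ^ j)
     / (qinf (A * d * Q ^ j) * qinf (A * e * Q ^ j) * qinf (A * f * Q ^ j)))"

context
  fixes A B d e :: complex
  assumes AB: "A \<noteq> 0" "B \<noteq> 0" and Ad: "qinf (A * d) \<noteq> 0" and Ae: "qinf (A * e) \<noteq> 0"
begin

lemma upper_term_tendsto: "upper_term A B d e f \<longlonglongrightarrow> qinf (B * d) * qinf (B * e) * qinf (B * f)"
proof -
  have "upper_term A B d e f \<longlonglongrightarrow> 1 * 1 * 1 * (qinf (B * d) * qinf (B * e) * qinf (B * f))"
    unfolding upper_term_def by (intro tendsto_intros qinf_Q_pow_tendsto qfin_tendsto)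
  then show ?thesis by simp
qed

lemma lower_term_tendsto: "lower_term A B d e f \<longlonglongrightarrow> 1"
proof -
  have "lower_term A B d e f \<longlonglongrightarrow> 1 * 1 * 1 / (1 * 1 * 1)"
    unfolding lower_term_def by (intro tendsto_intros qinf_Q_pow_tendsto) auto
  then show ?thesis by simp
qed

lemma upper_summable: "summable (\<lambda>j. Q ^ j * upper_term A B d e f j)"
  by (rule summable_Q_pow_mult[OF convergentI[OF upper_term_tendsto]])

lemma lower_summable: "summable (\<lambda>j. Q ^ j * lower_term A B d e f j)"
  by (rule summable_Q_pow_mult[OF convergentI[OF lower_term_tendsto]])

lemma upper_telescope:
  "B * ((1 - A * f) * (Q ^ j * upper_term A B d e f j)
     - (1 - A * B * e * f) * (1 - A * B * d * f) * (Q ^ j * upper_term A B d e (f * Q) j))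
   = upper_cert A B d e f j - upper_cert A B d e f (Suc j)"
proof (cases j)
  case 0
  have 1: "qinf (A * B * d * e * f * B) = (1 - A * B * d * e * f * B) * qinf (A * B * d * e * f * Q * B)"
    using qinf_step[of "A * B * d * e * f * B"] by (simp add: mult_ac)
  have 2: "A * B * d * e * (f * Q) * B * Q ^ 0 = A * B * d * e * f * Q * B" by simp
  show ?thesis
    unfolding 0 upper_term_def upper_cert_def 2 by (simp add: 1 qfin_Suc) algebra
next
  case (Suc i)
  define x where "x = Q ^ i"
  define y where "y = Q * x"
  define R where "R = qinf (B / A * Q * y) * qinf (Q * y) * qinf (A * B * d * e * f * Q * B * y)
      * (qfin (B * d) (Suc i) * qfin (B * e) (Suc i) * qfin (B * f * Q) i)"
  have y: "Q ^ j = y" "Q ^ Suc i = y" by (simp_all add: Suc x_def y_def)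
  have c1: "qinf (A * B * d * e * f * B * y)
      = (1 - A * B * d * e * f * B * y) * qinf (A * B * d * e * f * Q * B * y)"
    using qinf_step[of "A * B * d * e * f * B * y"] by (simp add: mult_ac)
  have c2: "qinf (B / A * Q * x) = (1 - B / A * y) * qinf (B / A * Q * y)"
    using qinf_step[of "B / A * y"] by (simp add: y_def mult_ac)
  have c3: "qinf (Q * x) = (1 - y) * qinf (Q * y)"
    using qinf_step[of y] by (simp add: y_def mult_ac)
  have c4: "A * B * d * e * f * Q * B * x = A * B * d * e * f * B * y"
    by (simp add: y_def mult_ac)
  have f1: "qfin (B * f) (Suc i) = (1 - B * f) * qfin (B * f * Q) i"
    by (rule qfin_Suc')
  have f2: "qfin (B * (f * Q)) (Suc i) = qfin (B * f * Q) i * (1 - B * f * y)"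
    by (simp add: qfin_Suc y_def x_def mult_ac)
  have f3: "qfin (B * f * Q) (Suc i) = qfin (B * f * Q) i * (1 - B * f * y)"
    by (simp add: qfin_Suc y_def x_def mult_ac)
  have f4: "qfin (B * d) (Suc (Suc i)) = qfin (B * d) (Suc i) * (1 - B * d * y)"
    "qfin (B * e) (Suc (Suc i)) = qfin (B * e) (Suc i) * (1 - B * e * y)"
    unfolding qfin_Suc[of _ "Suc i"] y by simp_all
  have u1: "upper_term A B d e f j = R * ((1 - A * B * d * e * f * B * y) * (1 - B * f))"
    unfolding upper_term_def y Suc c1 f1 R_def by (simp only: mult_ac)
  have u2: "upper_term A B d e (f * Q) j = R * (1 - B * f * y)"
    unfolding upper_term_def y Suc f2 R_def by (simp only: mult_ac)
  have g1: "upper_cert A B d e f j = A * B * f * R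
      * ((1 - A * B * d * e * f * B * y) * (1 - B / A * y) * (1 - y))"
    unfolding upper_cert_def Suc nat.case x_def[symmetric] c4 c1 c2 c3 R_def by (simp only: mult_ac)
  have g2: "upper_cert A B d e f (Suc j) = A * B * f * R * ((1 - B * d * y) * (1 - B * e * y) * (1 - B * f * y))"
    unfolding upper_cert_def nat.case Suc y f3 f4 R_def by (simp only: mult_ac)
  \<comment> \<open>Eliminating \<open>B = Aw\<close> leaves a polynomial identity.\<close>
  define w where "w = B / A"
  have B: "B = A * w" using AB by (simp add: w_def)
  show ?thesis unfolding u1 u2 g1 g2 y w_def[symmetric] unfolding B by algebra
qed

lemma lower_telescope:
  assumes Af: "qinf (A * f) \<noteq> 0"
  shows "A * (qinf (B * d) * qinf (B * e)) * ((1 - A * f) * (qinf (B * f) * (Q ^ j * lower_term A B d e f j))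
     - (1 - A * B * e * f) * (1 - A * B * d * f) * (qinf (B * f * Q) * (Q ^ j * lower_term A B d e (f * Q) j)))
   = lower_cert A B d e f j - lower_cert A B d e f (Suc j)"
proof -
  define y where "y = Q ^ j"
  define N where "N = qinf (Q * y) * qinf (A / B * Q * y) * qinf (A * B * d * e * f * A * Q * y)"
  define S where "S = qinf (A * d * y) * qinf (A * e * y) * qinf (A * f * y)"
  have nz: "1 - A * d * y \<noteq> 0" "1 - A * e * y \<noteq> 0" "1 - A * f * y \<noteq> 0"
      "qinf (A * d * y) \<noteq> 0" "qinf (A * e * y) \<noteq> 0" "qinf (A * f * y) \<noteq> 0"
    using qinf_factor_nz[OF Ad, of j] qinf_factor_nz[OF Ae, of j] qinf_factor_nz[OF Af, of j]
      qinf_shift_nz[OF Ad, of j] qinf_shift_nz[OF Ae, of j] qinf_shift_nz[OF Af, of j]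
    by (auto simp: y_def)
  have s: "qinf (A * d * Q * y) = qinf (A * d * y) / (1 - A * d * y)"
    "qinf (A * e * Q * y) = qinf (A * e * y) / (1 - A * e * y)"
    "qinf (A * f * Q * y) = qinf (A * f * y) / (1 - A * f * y)"
    using nz qinf_step[of "A * d * y"] qinf_step[of "A * e * y"] qinf_step[of "A * f * y"]
    by (simp_all add: field_simps)
  have c1: "qinf (A * B * d * e * f * A * y)
      = (1 - A * B * d * e * f * A * y) * qinf (A * B * d * e * f * A * Q * y)"
    using qinf_step[of "A * B * d * e * f * A * y"] by (simp add: mult_ac)
  have c2: "qinf (A / B * y) = (1 - A / B * y) * qinf (A / B * Q * y)"
    using qinf_step[of "A / B * y"] by (simp add: mult_ac)
  have c3: "qinf y = (1 - y) * qinf (Q * y)"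
    using qinf_step[of y] by (simp add: mult_ac)
  define M where "M = qinf (B * d) * qinf (B * e) * qinf (B * f * Q)"
  define W where "W = M * (N / S)"
  have bf: "qinf (B * f) = (1 - B * f) * qinf (B * f * Q)" by (rule qinf_step)
  have l1: "lower_term A B d e f j = N / S * (1 - A * B * d * e * f * A * y)"
    unfolding lower_term_def y_def[symmetric] c1 N_def S_def by simp
  have l2: "lower_term A B d e (f * Q) j = N / S * (1 - A * f * y)"
  proof -
    have eqs: "A * B * d * e * (f * Q) * A * y = A * B * d * e * f * A * Q * y"
      "A * (f * Q) * y = A * f * Q * y" by simp_all
    show ?thesis unfolding lower_term_def y_def[symmetric] eqs s(3) N_def S_def by simp
  qed
  have g1: "lower_cert A B d e f j = A * B * f * W * ((1 - y) * (1 - A / B * y) * (1 - A * B * d * e * f * A * y))"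
    unfolding lower_cert_def y_def[symmetric] c1 c2 c3 W_def M_def N_def S_def by simp
  have g2: "lower_cert A B d e f (Suc j) = A * B * f * W * ((1 - A * d * y) * (1 - A * e * y) * (1 - A * f * y))"
  proof -
    have yy: "Q ^ Suc j = Q * y" by (simp add: y_def)
    have eqs: "A * B * d * e * f * A * (Q * y) = A * B * d * e * f * A * Q * y"
      "A / B * (Q * y) = A / B * Q * y" "A * d * (Q * y) = A * d * Q * y"
      "A * e * (Q * y) = A * e * Q * y" "A * f * (Q * y) = A * f * Q * y" by simp_all
    show ?thesis unfolding lower_cert_def yy eqs s W_def M_def N_def S_def by simp
  qed
  \<comment> \<open>Eliminating \<open>A = Bw\<close> leaves a polynomial identity.\<close>
  define w where "w = A / B"
  define V where "V = N / S"
  define b1 b2 b3 where "b1 = qinf (B * d)" "b2 = qinf (B * e)" "b3 = qinf (B * f * Q)"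
  have A: "A = B * w" using AB by (simp add: w_def)
  show ?thesis
    unfolding l1 l2 bf y_def[symmetric] g1 g2 W_def M_def w_def[symmetric] V_def[symmetric]
      b1_b2_b3_def[symmetric]
    unfolding A by algebra
qed

text \<open>
  Both telescoping sums start at \<open>0\<close>, since the certificate vanishes at \<open>t = A\<close> and \<open>t = B\<close>, and both
  tend to the same value at \<open>t = 0\<close>; their difference is therefore \<open>0\<close>.
\<close>

lemma saal_integral_recurrence:
  assumes Af: "qinf (A * f) \<noteq> 0"
  shows "(1 - A * f) * saal_integral A B d e f
    = (1 - A * B * e * f) * (1 - A * B * d * f) * saal_integral A B d e (f * Q)"
proof -
  define L where "L = A * B * f * (qinf (B * d) * qinf (B * e) * qinf (B * f * Q))"
  define K where "K = (1 - A * B * e * f) * (1 - A * B * d * f)"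
  have "upper_cert A B d e f \<longlonglongrightarrow> L"
  proof -
    have "(\<lambda>j. upper_cert A B d e f (Suc j)) \<longlonglongrightarrow> A * B * f * (1 * 1 * 1 * (qinf (B * d) * qinf (B * e) * qinf (B * f * Q)))"
      unfolding upper_cert_def nat.case
      by (intro tendsto_intros qinf_Q_pow_tendsto qfin_tendsto LIMSEQ_Suc)
    then show ?thesis unfolding L_def by (subst filterlim_sequentially_Suc[symmetric]) simp
  qed
  then have "(\<lambda>j. upper_cert A B d e f j - upper_cert A B d e f (Suc j)) sums (upper_cert A B d e f 0 - L)"
    by (rule telescope_sums')
  then have "(\<lambda>j. B * ((1 - A * f) * (Q ^ j * upper_term A B d e f j)
      - K * (Q ^ j * upper_term A B d e (f * Q) j))) sums (- L)"
    unfolding K_def upper_telescope by (simp add: upper_cert_def)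
  moreover have "(\<lambda>j. B * ((1 - A * f) * (Q ^ j * upper_term A B d e f j)
      - K * (Q ^ j * upper_term A B d e (f * Q) j))) sums
     (B * ((1 - A * f) * (\<Sum>j. Q ^ j * upper_term A B d e f j)
      - K * (\<Sum>j. Q ^ j * upper_term A B d e (f * Q) j)))"
    by (intro sums_mult sums_diff summable_sums upper_summable)
  ultimately have U: "B * ((1 - A * f) * (\<Sum>j. Q ^ j * upper_term A B d e f j)
      - K * (\<Sum>j. Q ^ j * upper_term A B d e (f * Q) j)) = - L"
    by (rule sums_unique2[symmetric])
  have "lower_cert A B d e f \<longlonglongrightarrow> L"
  proof -
    have "(\<lambda>j. qinf (Q ^ j)) \<longlonglongrightarrow> 1" using qinf_Q_pow_tendsto[of 1] by simp
    then have "lower_cert A B d e f \<longlonglongrightarrow> L * (1 * 1 * 1 / (1 * 1 * 1))"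
      unfolding lower_cert_def L_def by (intro tendsto_intros qinf_Q_pow_tendsto) auto
    then show ?thesis by simp
  qed
  then have "(\<lambda>j. lower_cert A B d e f j - lower_cert A B d e f (Suc j)) sums (lower_cert A B d e f 0 - L)"
    by (rule telescope_sums')
  then have "(\<lambda>j. A * (qinf (B * d) * qinf (B * e)) * ((1 - A * f) * (qinf (B * f) * (Q ^ j * lower_term A B d e f j))
     - K * (qinf (B * f * Q) * (Q ^ j * lower_term A B d e (f * Q) j)))) sums (- L)"
    unfolding K_def lower_telescope[OF Af] by (simp add: lower_cert_def)
  moreover have "(\<lambda>j. A * (qinf (B * d) * qinf (B * e)) * ((1 - A * f) * (qinf (B * f) * (Q ^ j * lower_term A B d e f j))
     - K * (qinf (B * f * Q) * (Q ^ j * lower_term A B d e (f * Q) j)))) sums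
     (A * (qinf (B * d) * qinf (B * e)) * ((1 - A * f) * (qinf (B * f) * (\<Sum>j. Q ^ j * lower_term A B d e f j))
     - K * (qinf (B * f * Q) * (\<Sum>j. Q ^ j * lower_term A B d e (f * Q) j))))"
    by (intro sums_mult sums_diff summable_sums lower_summable)
  ultimately have Lo: "A * (qinf (B * d) * qinf (B * e)) * ((1 - A * f) * (qinf (B * f) * (\<Sum>j. Q ^ j * lower_term A B d e f j))
     - K * (qinf (B * f * Q) * (\<Sum>j. Q ^ j * lower_term A B d e (f * Q) j))) = - L"
    by (rule sums_unique2[symmetric])
  have eq: "B * (f * Q) = B * f * Q" by simp
  show ?thesis
    using U Lo unfolding saal_integral_def K_def[symmetric] eq by algebra
qed

lemma saal_integral_tendsto:
  assumes Af: "qinf (A * f) \<noteq> 0"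
  shows "(\<lambda>n. saal_integral A B d e (f * Q ^ n)) \<longlonglongrightarrow> saal_integral A B d e 0"
proof -
  define M where "M x = exp (norm x / (1 - q))" for x :: complex
  have M: "norm (qinf (x * Q ^ n)) \<le> M x" "norm (qfin (x * Q ^ n) m) \<le> M x" "norm (qfin x m) \<le> M x" "0 \<le> M x" for x n m
  proof -
    have "norm (x * Q ^ n) \<le> norm x"
      using q_pow_le_1[of n] by (simp add: norm_mult norm_power mult_left_le)
    then show "norm (qinf (x * Q ^ n)) \<le> M x" "norm (qfin (x * Q ^ n) m) \<le> M x"
      unfolding M_def by (intro norm_qinf_le norm_qfin_le; assumption)+
  qed (auto simp: M_def intro: norm_qfin_le)
  have inv: "\<exists>C>0. \<forall>n. norm (inverse (qinf (x * Q ^ n))) \<le> C" if "qinf x \<noteq> 0" for x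
  proof -
    have "(\<lambda>n. inverse (qinf (x * Q ^ n))) \<longlonglongrightarrow> inverse 1"
      by (intro tendsto_inverse qinf_Q_pow_tendsto) simp
    then have "Bseq (\<lambda>n. inverse (qinf (x * Q ^ n)))"
      by (intro convergent_imp_Bseq convergentI)
    then show ?thesis by (auto simp: Bseq_def)
  qed
  obtain C1 where C1: "C1 > 0" "\<And>n. norm (inverse (qinf (A * d * Q ^ n))) \<le> C1"
    using inv[OF Ad] by auto
  obtain C2 where C2: "C2 > 0" "\<And>n. norm (inverse (qinf (A * e * Q ^ n))) \<le> C2"
    using inv[OF Ae] by auto
  obtain C3 where C3: "C3 > 0" "\<And>n. norm (inverse (qinf (A * f * Q ^ n))) \<le> C3"
    using inv[OF Af] by auto
  have shift: "x * (f * Q ^ n) = x * f * Q ^ n" "x * f * Q ^ n * y * Q ^ j = x * f * y * Q ^ (n + j)"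
    "x * f * Q ^ n * Q ^ j = x * f * Q ^ (n + j)" for x y n j
    by (simp_all add: power_add)
  have f0: "(\<lambda>n. f * Q ^ n) \<longlonglongrightarrow> 0"
    by (intro tendsto_mult_right_zero Q_pow_tendsto_0)
  have U: "(\<lambda>n. \<Sum>j. Q ^ j * upper_term A B d e (f * Q ^ n) j) \<longlonglongrightarrow> (\<Sum>j. Q ^ j * upper_term A B d e 0 j)"
  proof (rule suminf_Q_pow_tendsto)
    show "(\<lambda>n. upper_term A B d e (f * Q ^ n) j) \<longlonglongrightarrow> upper_term A B d e 0 j" for j
      unfolding upper_term_def qfin_def by (intro tendsto_intros qinf_tendsto f0)
    show "norm (upper_term A B d e (f * Q ^ n) j)
        \<le> M (B / A * Q) * M Q * M (A * B * d * e * f * B) * (M (B * d) * M (B * e) * M (B * f))" for j n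
      unfolding upper_term_def norm_mult shift
      by (intro mult_mono M mult_nonneg_nonneg norm_ge_zero)
  qed
  have L: "(\<lambda>n. \<Sum>j. Q ^ j * lower_term A B d e (f * Q ^ n) j) \<longlonglongrightarrow> (\<Sum>j. Q ^ j * lower_term A B d e 0 j)"
  proof (rule suminf_Q_pow_tendsto)
    show "(\<lambda>n. lower_term A B d e (f * Q ^ n) j) \<longlonglongrightarrow> lower_term A B d e 0 j" for j
      unfolding lower_term_def
      by (intro tendsto_intros qinf_tendsto f0)
         (use qinf_shift_nz[OF Ad, of j] qinf_shift_nz[OF Ae, of j] in auto)
    show "norm (lower_term A B d e (f * Q ^ n) j)
        \<le> M Q * M (A / B * Q) * M (A * B * d * e * f * A) * (C1 * C2 * C3)" for j n
      unfolding lower_term_def divide_inverse inverse_mult_distrib norm_mult shift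
      by (intro mult_mono M C1 C2 C3 mult_nonneg_nonneg norm_ge_zero less_imp_le[OF C1(1)] less_imp_le[OF C2(1)])
  qed
  show ?thesis
    unfolding saal_integral_def by (intro tendsto_intros U L qinf_tendsto f0)
qed

lemma saal_integral_reduce:
  assumes Af: "qinf (A * f) \<noteq> 0"
  shows "qinf (A * f) * saal_integral A B d e f
    = qinf (A * B * e * f) * qinf (A * B * d * f) * saal_integral A B d e 0"
proof -
  have fin: "qfin (A * f) n * saal_integral A B d e f
    = qfin (A * B * e * f) n * qfin (A * B * d * f) n * saal_integral A B d e (f * Q ^ n)" for n
  proof (induction n)
    case (Suc n)
    have nz: "qinf (A * (f * Q ^ n)) \<noteq> 0"
      using qinf_shift_nz[OF Af, of n] by (simp add: mult_ac)
    have rec: "(1 - A * f * Q ^ n) * saal_integral A B d e (f * Q ^ n)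
        = (1 - A * B * e * f * Q ^ n) * (1 - A * B * d * f * Q ^ n) * saal_integral A B d e (f * Q ^ Suc n)"
      using saal_integral_recurrence[OF nz] by (simp add: mult_ac)
    have "qfin (A * f) (Suc n) * saal_integral A B d e f
        = (1 - A * f * Q ^ n) * (qfin (A * f) n * saal_integral A B d e f)"
      by (simp add: qfin_Suc mult_ac)
    also have "\<dots> = (qfin (A * B * e * f) n * qfin (A * B * d * f) n)
        * ((1 - A * f * Q ^ n) * saal_integral A B d e (f * Q ^ n))"
      unfolding Suc.IH by (simp only: mult_ac)
    also have "\<dots> = qfin (A * B * e * f) (Suc n) * qfin (A * B * d * f) (Suc n) * saal_integral A B d e (f * Q ^ Suc n)"
      unfolding rec qfin_Suc by (simp only: mult_ac)
    finally show ?case .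
  qed simp
  show ?thesis
  proof (rule LIMSEQ_unique)
    show "(\<lambda>n. qfin (A * f) n * saal_integral A B d e f) \<longlonglongrightarrow> qinf (A * f) * saal_integral A B d e f"
      by (intro tendsto_intros qfin_tendsto)
    show "(\<lambda>n. qfin (A * f) n * saal_integral A B d e f)
        \<longlonglongrightarrow> qinf (A * B * e * f) * qinf (A * B * d * f) * saal_integral A B d e 0"
      unfolding fin by (intro tendsto_intros qfin_tendsto saal_integral_tendsto[OF Af])
  qed
qed

end

text \<open>
  Telescoping of \<open>(x; q)\<^sub>\<infinity> = (1 - x) (xq; q)\<^sub>\<infinity>\<close>.
\<close>

lemma euler_sums: "(\<lambda>j. x * Q ^ j * qinf (x * Q * Q ^ j)) sums (1 - qinf x)"
proof -
  have "(\<lambda>j. qinf (x * Q ^ Suc j) - qinf (x * Q ^ j)) sums (1 - qinf (x * Q ^ 0))"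
    by (rule telescope_sums[OF qinf_Q_pow_tendsto])
  moreover have "qinf (x * Q ^ Suc j) - qinf (x * Q ^ j) = x * Q ^ j * qinf (x * Q * Q ^ j)" for j
    using qinf_step[of "x * Q ^ j"] by (simp add: algebra_simps)
  ultimately show ?thesis by simp
qed

text \<open>
  For \<open>f = q/A\<close> the factor \<open>(ft; q)\<^sub>\<infinity>\<close> cancels \<open>(qt/A; q)\<^sub>\<infinity>\<close>, and both lattice sums are of the type
  \<open>euler_sums\<close>.
\<close>

lemma saal_integral_base:
  assumes AB: "A \<noteq> 0" "B \<noteq> 0"
  shows "saal_integral A B 0 0 (Q / A) = B * (qinf (B / A * Q) * qinf (A / B))"
proof -
  have u: "Q ^ j * upper_term A B 0 0 (Q / A) j = qinf (B / A * Q) * (1 * Q ^ j * qinf (1 * Q * Q ^ j))" for j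
    using qinf_split[of "B / A * Q" j] by (simp add: upper_term_def mult_ac)
  have "(\<lambda>j. Q ^ j * upper_term A B 0 0 (Q / A) j) sums (qinf (B / A * Q) * (1 - qinf 1))"
    unfolding u by (intro sums_mult euler_sums)
  then have U: "(\<Sum>j. Q ^ j * upper_term A B 0 0 (Q / A) j) = qinf (B / A * Q)"
    by (auto simp: sums_iff)
  have l: "Q ^ j * lower_term A B 0 0 (Q / A) j = B / A * (A / B * Q ^ j * qinf (A / B * Q * Q ^ j))" for j
    using AB qinf_shift_nz[OF qinf_Q_nz, of j] by (simp add: lower_term_def mult_ac)
  have "(\<lambda>j. Q ^ j * lower_term A B 0 0 (Q / A) j) sums (B / A * (1 - qinf (A / B)))"
    unfolding l by (intro sums_mult euler_sums)
  then have L: "(\<Sum>j. Q ^ j * lower_term A B 0 0 (Q / A) j) = B / A * (1 - qinf (A / B))"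
    by (auto simp: sums_iff)
  show ?thesis
    unfolding saal_integral_def U L using AB by (simp add: field_simps)
qed

text \<open>
  The integral is symmetric in \<open>d, e, f\<close>, so \<open>saal_integral_reduce\<close> replaces them by \<open>0\<close> one after the
  other. Read backwards at \<open>f = q/A\<close>, the same reduction gives the value at \<open>d = e = f = 0\<close> from
  \<open>saal_integral_base\<close>.
\<close>

theorem nonterminating_saalschuetz:
  assumes AB: "A \<noteq> 0" "B \<noteq> 0"
    and nz: "qinf (A * d) \<noteq> 0" "qinf (A * e) \<noteq> 0" "qinf (A * f) \<noteq> 0"
  shows "saal_integral A B d e f = B * (qinf Q * qinf (B / A * Q) * qinf (A / B)
      * (qinf (A * B * d * e) * qinf (A * B * d * f) * qinf (A * B * e * f)))
    / (qinf (A * d) * qinf (A * e) * qinf (A * f))"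
proof -
  have z: "qinf (A * 0) \<noteq> 0" by simp
  have AQ: "A * (Q / A) = Q" using AB by simp
  have f: "qinf (A * f) * saal_integral A B d e f
      = qinf (A * B * e * f) * qinf (A * B * d * f) * saal_integral A B d e 0"
    by (rule saal_integral_reduce[OF AB nz])
  have e: "qinf (A * e) * saal_integral A B d e 0 = qinf (A * B * d * e) * saal_integral A B d 0 0"
    using saal_integral_reduce[OF AB nz(1) z nz(2)] saal_integral_commute(1)[of A B d e 0] by simp
  have d: "qinf (A * d) * saal_integral A B d 0 0 = qinf Q * saal_integral A B 0 0 (Q / A)"
    using saal_integral_reduce[OF AB z z nz(1)] saal_integral_reduce[OF AB z z, of "Q / A"]
      saal_integral_commute(2)[of A B d 0 0]
    unfolding AQ by simp
  have "qinf (A * f) * qinf (A * e) * qinf (A * d) * saal_integral A B d e f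
      = qinf (A * B * e * f) * qinf (A * B * d * f) * qinf (A * B * d * e)
        * (qinf Q * saal_integral A B 0 0 (Q / A))"
    using d e f by algebra
  then have "qinf (A * f) * qinf (A * e) * qinf (A * d) * saal_integral A B d e f
      = qinf (A * B * e * f) * qinf (A * B * d * f) * qinf (A * B * d * e)
        * (qinf Q * (B * (qinf (B / A * Q) * qinf (A / B))))"
    unfolding saal_integral_base[OF AB] .
  then show ?thesis using nz by (simp add: eq_divide_eq mult_ac)
qed

section \<open>The nonterminating Watson transformation\<close>

definition node_lead :: "nat \<Rightarrow> complex" where
  "node_lead k = (\<Prod>i<k. - (Q ^ i))"

lemma node_poly_eq: "node_poly t k = node_lead k * qfin (t * Q / Q ^ k) k"
proof (induction k)
  case (Suc k)
  have "qfin (t * Q / Q ^ Suc k) (Suc k) = (1 - t / Q ^ k) * qfin (t * Q / Q ^ k) k"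
    unfolding qfin_Suc' by simp
  moreover have "node_lead (Suc k) * (1 - t / Q ^ k) = node_lead k * (t - Q ^ k)"
    by (simp add: node_lead_def algebra_simps)
  ultimately show ?case
    unfolding node_poly_Suc Suc.IH by (simp add: mult_ac)
qed (simp add: node_lead_def)

text \<open>
  The polynomial of degree \<open>k\<close> moves the upper end of the q-integral from \<open>1\<close> to \<open>q\<^sup>k\<close>.
\<close>

lemma node_poly_mult_qinf: "node_poly t k * qinf (Q * t) = node_lead k * qinf (t / Q ^ k * Q)"
proof -
  have "qinf (t / Q ^ k * Q) = qfin (t * Q / Q ^ k) k * qinf (Q * t)"
    using qinf_split[of "t / Q ^ k * Q" k] by (simp add: mult_ac)
  then show ?thesis unfolding node_poly_eq by simp
qed

text \<open>
  Quasi-periodicity of the theta function \<open>(\<tau>, q/\<tau>; q)\<^sub>\<infinity>\<close>: its multiplier cancels the leading factors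
  and produces the power \<open>\<tau>\<^sup>k\<close> of the very-well-poised series.
\<close>

lemma theta_shift:
  assumes "\<tau> \<noteq> 0" "qinf (Q / \<tau>) \<noteq> 0"
  shows "node_lead k * Q ^ k * (qinf (Q ^ k / \<tau> * Q) * qinf (\<tau> / Q ^ k)) = \<tau> ^ k * (qinf (Q / \<tau>) * qinf \<tau>)"
proof (induction k)
  case 0
  show ?case by (simp add: node_lead_def)
next
  case (Suc k)
  have nz: "1 - Q ^ Suc k / \<tau> \<noteq> 0"
    using qinf_factor_nz[OF assms(2), of k] by simp
  have 1: "qinf (Q ^ k / \<tau> * Q) = (1 - Q ^ Suc k / \<tau>) * qinf (Q ^ Suc k / \<tau> * Q)"
    using qinf_step[of "Q ^ k / \<tau> * Q"] by (simp add: mult_ac)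
  have 2: "qinf (\<tau> / Q ^ Suc k) = (1 - \<tau> / Q ^ Suc k) * qinf (\<tau> / Q ^ k)"
    using qinf_step[of "\<tau> / Q ^ Suc k"] by simp
  have 3: "- (Q ^ Suc k) * (1 - \<tau> / Q ^ Suc k) = \<tau> * (1 - Q ^ Suc k / \<tau>)"
    using assms by (simp add: field_simps)
  have 4: "node_lead (Suc k) * Q ^ Suc k = node_lead k * Q ^ k * (- (Q ^ Suc k))"
    by (simp add: node_lead_def)
  have "node_lead (Suc k) * Q ^ Suc k * (qinf (Q ^ Suc k / \<tau> * Q) * qinf (\<tau> / Q ^ Suc k))
      = node_lead k * Q ^ k * (- (Q ^ Suc k) * (1 - \<tau> / Q ^ Suc k)) * (qinf (Q ^ Suc k / \<tau> * Q) * qinf (\<tau> / Q ^ k))"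
    unfolding 4 2 by (simp only: mult_ac)
  also have "\<dots> = \<tau> * (node_lead k * Q ^ k * (qinf (Q ^ k / \<tau> * Q) * qinf (\<tau> / Q ^ k)))"
    unfolding 3 1 by (simp only: mult_ac)
  finally show ?case unfolding Suc.IH by simp
qed

lemma norm_node_poly_Q_pow_le: "norm (node_poly (Q ^ j) k) \<le> (\<Prod>i<k. q ^ i)"
proof (cases "j < k")
  case True
  then show ?thesis using q_pos by (simp add: node_poly_Q_pow prod_nonneg)
next
  case False
  have "norm (Q ^ j - Q ^ i) \<le> q ^ i" if "i < k" for i
  proof -
    have "norm (Q ^ j - Q ^ i) = \<bar>q ^ j - q ^ i\<bar>"
      by (metis of_real_diff of_real_power norm_of_real)
    moreover have "q ^ j \<le> q ^ i" "0 \<le> q ^ j"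
      using that False q_pos q_less_1 by (auto intro: power_decreasing)
    ultimately show ?thesis by simp
  qed
  then show ?thesis
    unfolding node_poly_def prod_norm[symmetric] by (intro prod_mono) auto
qed

lemma summable_gaussian: "summable (\<lambda>k. C ^ k * (\<Prod>i<k. q ^ i))" for C :: real
proof -
  have "(\<lambda>k. C * q ^ k) \<longlonglongrightarrow> C * 0"
    using q_pos q_less_1 by (intro tendsto_intros LIMSEQ_realpow_zero) auto
  then have "\<forall>\<^sub>F k in sequentially. norm (C * q ^ k) < 1/2"
    by (intro order_tendstoD(2)[OF tendsto_norm]) auto
  then obtain N where N: "\<And>k. k \<ge> N \<Longrightarrow> norm (C * q ^ k) < 1/2"
    by (auto simp: eventually_sequentially)
  show ?thesis
  proof (rule summable_ratio_test[where c = "1/2" and N = N])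
    fix n assume "N \<le> n"
    have "norm (C ^ Suc n * (\<Prod>i<Suc n. q ^ i)) = norm (C * q ^ n) * norm (C ^ n * (\<Prod>i<n. q ^ i))"
      by (simp add: abs_mult)
    also have "\<dots> \<le> 1/2 * norm (C ^ n * (\<Prod>i<n. q ^ i))"
      using N[OF \<open>N \<le> n\<close>] by (intro mult_right_mono) auto
    finally show "norm (C ^ Suc n * (\<Prod>i<Suc n. q ^ i)) \<le> 1/2 * norm (C ^ n * (\<Prod>i<n. q ^ i))" .
  qed simp
qed

text \<open>
  The part of the integrand that is not expanded, on the lattice \<open>q\<^sup>j\<close> (normalized by \<open>(d, e, f; q)\<^sub>\<infinity>\<close>)
  and on the lattice \<open>\<tau>q\<^sup>j\<close>.
\<close>

definition upper_weight :: "complex \<Rightarrow> complex \<Rightarrow> complex \<Rightarrow> complex \<Rightarrow> nat \<Rightarrow> complex" where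
  "upper_weight d e f \<tau> j = qinf (Q * Q ^ j) * qinf (Q / \<tau> * Q ^ j) * (qfin d j * qfin e j * qfin f j)"

definition lower_weight :: "complex \<Rightarrow> complex \<Rightarrow> complex \<Rightarrow> complex \<Rightarrow> nat \<Rightarrow> complex" where
  "lower_weight d e f \<tau> j = qinf (Q * Q ^ j) * qinf (\<tau> * Q * Q ^ j)
     / (qinf (\<tau> * d * Q ^ j) * qinf (\<tau> * e * Q ^ j) * qinf (\<tau> * f * Q ^ j))"

context
  fixes \<alpha> b c u d e f \<tau> :: complex
  assumes well_poised: "\<alpha> * Q = u * b * c" and balanced: "\<tau> * d * e * f = \<alpha> * Q"
    and alpha: "\<alpha> \<noteq> 1" and tau: "\<tau> \<noteq> 0"
    and conv: "norm (u * \<tau>) < 1"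
    and nz: "qinf (u * b) \<noteq> 0" "qinf (u * c) \<noteq> 0" "qinf (\<tau> * d) \<noteq> 0" "qinf (\<tau> * e) \<noteq> 0"
      "qinf (\<tau> * f) \<noteq> 0" "qinf (Q / \<tau>) \<noteq> 0"
begin

lemma upper_weight_convergent: "convergent (upper_weight d e f \<tau>)"
proof -
  have "upper_weight d e f \<tau> \<longlonglongrightarrow> 1 * 1 * (qinf d * qinf e * qinf f)"
    unfolding upper_weight_def by (intro tendsto_intros qinf_Q_pow_tendsto qfin_tendsto)
  then show ?thesis by (rule convergentI)
qed

lemma lower_weight_convergent: "convergent (lower_weight d e f \<tau>)"
proof -
  have "lower_weight d e f \<tau> \<longlonglongrightarrow> 1 * 1 / (1 * 1 * 1)"
    unfolding lower_weight_def by (intro tendsto_intros qinf_Q_pow_tendsto) auto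
  then show ?thesis by (rule convergentI)
qed

text \<open>
  The first \<open>k\<close> nodes contribute nothing; the rest is the lattice \<open>q\<^sup>kq\<^sup>i\<close> of a q-Saalschuetz integral
  with upper end \<open>q\<^sup>k\<close>.
\<close>

lemma upper_inner:
  "(\<Sum>j. Q ^ j * upper_weight d e f \<tau> j * (node_poly (Q ^ j) k * qinf (\<alpha> * Q ^ Suc k * Q ^ j)))
   = node_lead k * (qfin d k * qfin e k * qfin f k) * (Q ^ k * (\<Sum>i. Q ^ i * upper_term \<tau> (Q ^ k) d e f i))"
proof -
  let ?g = "\<lambda>j. Q ^ j * upper_weight d e f \<tau> j * (node_poly (Q ^ j) k * qinf (\<alpha> * Q ^ Suc k * Q ^ j))"
  have eq: "?g (i + k) = node_lead k * (qfin d k * qfin e k * qfin f k) * Q ^ k * (Q ^ i * upper_term \<tau> (Q ^ k) d e f i)" for i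
  proof -
    have 1: "node_poly (Q ^ (i + k)) k * qinf (Q * Q ^ (i + k)) = node_lead k * qinf (Q * Q ^ i)"
      unfolding node_poly_mult_qinf by (simp add: power_add mult_ac)
    have 2: "qfin x (i + k) = qfin x k * qfin (Q ^ k * x) i" for x
      using qfin_add[of x k i] by (simp add: add.commute mult.commute)
    have 3: "\<alpha> * Q ^ Suc k * Q ^ (i + k) = \<tau> * Q ^ k * d * e * f * Q ^ k * Q ^ i"
    proof -
      have "\<alpha> * Q ^ Suc k * Q ^ (i + k) = (\<alpha> * Q) * (Q ^ k * Q ^ k * Q ^ i)"
        by (simp add: power_add mult_ac)
      then show ?thesis unfolding balanced[symmetric] by (simp only: mult_ac)
    qed
    have 4: "Q / \<tau> * Q ^ (i + k) = Q ^ k / \<tau> * Q * Q ^ i" by (simp add: power_add)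
    have "?g (i + k) = Q ^ (i + k) * (qfin d (i + k) * qfin e (i + k) * qfin f (i + k))
        * (node_poly (Q ^ (i + k)) k * qinf (Q * Q ^ (i + k))) * qinf (Q / \<tau> * Q ^ (i + k)) * qinf (\<alpha> * Q ^ Suc k * Q ^ (i + k))"
      unfolding upper_weight_def by (simp only: mult_ac)
    also have "\<dots> = node_lead k * (qfin d k * qfin e k * qfin f k) * Q ^ k * (Q ^ i * upper_term \<tau> (Q ^ k) d e f i)"
      unfolding 1 2 3 4 upper_term_def unfolding power_add by (simp only: mult_ac)
    finally show ?thesis .
  qed
  have Q0: "Q ^ k \<noteq> 0" by simp
  have "(\<lambda>i. ?g (i + k)) sums (node_lead k * (qfin d k * qfin e k * qfin f k) * Q ^ k * (\<Sum>i. Q ^ i * upper_term \<tau> (Q ^ k) d e f i))"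
    unfolding eq by (intro sums_mult summable_sums upper_summable[OF tau Q0 nz(3,4)])
  then have "?g sums (node_lead k * (qfin d k * qfin e k * qfin f k) * Q ^ k * (\<Sum>i. Q ^ i * upper_term \<tau> (Q ^ k) d e f i) + (\<Sum>j<k. ?g j))"
    by (subst sums_iff_shift[symmetric]) simp
  moreover have "(\<Sum>j<k. ?g j) = 0"
    by (intro sum.neutral) (simp add: node_poly_Q_pow)
  ultimately show ?thesis by (simp add: sums_iff mult_ac)
qed

lemma lower_inner:
  "(\<Sum>j. Q ^ j * lower_weight d e f \<tau> j * (node_poly (\<tau> * Q ^ j) k * qinf (\<alpha> * Q ^ Suc k * (\<tau> * Q ^ j))))
   = node_lead k * (\<Sum>j. Q ^ j * lower_term \<tau> (Q ^ k) d e f j)"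
proof -
  have Q0: "Q ^ k \<noteq> 0" by simp
  have eq: "Q ^ j * lower_weight d e f \<tau> j * (node_poly (\<tau> * Q ^ j) k * qinf (\<alpha> * Q ^ Suc k * (\<tau> * Q ^ j)))
     = node_lead k * (Q ^ j * lower_term \<tau> (Q ^ k) d e f j)" for j
  proof -
    have 1: "node_poly (\<tau> * Q ^ j) k * qinf (\<tau> * Q * Q ^ j) = node_lead k * qinf (\<tau> / Q ^ k * Q * Q ^ j)"
      using node_poly_mult_qinf[of "\<tau> * Q ^ j" k] by (simp add: mult_ac)
    have 3: "\<alpha> * Q ^ Suc k * (\<tau> * Q ^ j) = \<tau> * Q ^ k * d * e * f * \<tau> * Q ^ j"
    proof -
      have "\<alpha> * Q ^ Suc k * (\<tau> * Q ^ j) = (\<alpha> * Q) * (Q ^ k * \<tau> * Q ^ j)" by (simp add: mult_ac)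
      then show ?thesis unfolding balanced[symmetric] by (simp only: mult_ac)
    qed
    have eq: "Q ^ j * lower_weight d e f \<tau> j * (node_poly (\<tau> * Q ^ j) k * qinf (\<alpha> * Q ^ Suc k * (\<tau> * Q ^ j)))
      = Q ^ j * ((node_poly (\<tau> * Q ^ j) k * qinf (\<tau> * Q * Q ^ j)) * (qinf (Q * Q ^ j) * qinf (\<alpha> * Q ^ Suc k * (\<tau> * Q ^ j)))
       / (qinf (\<tau> * d * Q ^ j) * qinf (\<tau> * e * Q ^ j) * qinf (\<tau> * f * Q ^ j)))"
      unfolding lower_weight_def by (simp add: mult_ac)
    then show ?thesis unfolding 1 3 lower_term_def by (simp add: mult_ac)
  qed
  show ?thesis
    unfolding eq by (rule suminf_mult[OF lower_summable[OF tau Q0 nz(3,4)]])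
qed

lemma vwp_swap:
  assumes w: "convergent w" and M: "summable M" "\<And>j k. norm (vwp_term \<alpha> b c u (t j) k) \<le> M k"
  shows "(\<lambda>k. vwp_coeff \<alpha> b c u k
      * (\<Sum>j. Q ^ j * w j * (node_poly (t j) k * qinf (\<alpha> * Q ^ Suc k * t j))))
    sums (\<Sum>j. Q ^ j * w j * vwp_sum \<alpha> b c u (t j))"
proof -
  obtain C where C: "\<And>j. norm (w j) \<le> C"
    using convergent_imp_Bseq[OF w] by (auto simp: Bseq_def)
  have C0: "0 \<le> C" using C[of 0] norm_ge_zero order_trans by blast
  have M0: "0 \<le> M k" for k using M(2)[of undefined k] norm_ge_zero order_trans by blast
  have rC: "summable (\<lambda>j. C * q ^ j)" by (intro summable_mult summable_q_pow)
  have le: "norm (Q ^ j * w j * vwp_term \<alpha> b c u (t j) k) \<le> C * q ^ j * M k" for j k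
  proof -
    have "norm (Q ^ j * w j * vwp_term \<alpha> b c u (t j) k) = norm (w j) * q ^ j * norm (vwp_term \<alpha> b c u (t j) k)"
      by (simp add: norm_mult norm_power)
    also have "\<dots> \<le> C * q ^ j * M k"
      using q_pos by (intro mult_mono C M mult_nonneg_nonneg C0) auto
    finally show ?thesis .
  qed
  have row: "(\<Sum>k. Q ^ j * w j * vwp_term \<alpha> b c u (t j) k) = Q ^ j * w j * vwp_sum \<alpha> b c u (t j)" for j
    unfolding vwp_sum_def
    by (rule suminf_mult, rule summable_comparison_test'[where N = 0, OF M(1)], rule M(2))
  have col: "(\<Sum>j. Q ^ j * w j * vwp_term \<alpha> b c u (t j) k) = vwp_coeff \<alpha> b c u k
      * (\<Sum>j. Q ^ j * w j * (node_poly (t j) k * qinf (\<alpha> * Q ^ Suc k * t j)))" for k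
  proof (cases "vwp_coeff \<alpha> b c u k = 0")
    case False
    have eq: "Q ^ j * w j * vwp_term \<alpha> b c u (t j) k = vwp_coeff \<alpha> b c u k
      * (Q ^ j * w j * (node_poly (t j) k * qinf (\<alpha> * Q ^ Suc k * t j)))" for j
      unfolding vwp_term_def by (simp only: mult_ac)
    have "summable (\<lambda>j. Q ^ j * w j * vwp_term \<alpha> b c u (t j) k)"
      by (rule summable_comparison_test'[where N = 0, OF summable_mult2[OF rC]]) (rule le)
    then have "summable (\<lambda>j. Q ^ j * w j * (node_poly (t j) k * qinf (\<alpha> * Q ^ Suc k * t j)))"
      unfolding eq by (rule summable_mult_D) (rule False)
    then show ?thesis unfolding eq by (rule suminf_mult)
  qed (simp add: vwp_term_def)
  have "(\<lambda>k. \<Sum>j. Q ^ j * w j * vwp_term \<alpha> b c u (t j) k) sums (\<Sum>j. \<Sum>k. Q ^ j * w j * vwp_term \<alpha> b c u (t j) k)"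
    by (rule sums_swap[OF le rC _ M(1) M0]) (use C0 q_pos in auto)
  then show ?thesis unfolding row col .
qed

text \<open>
  On this lattice the series in \<open>k\<close> need not converge geometrically, but
  \<open>\<bar>(q\<^bsup>-j\<^esup>; q)\<^sub>k q\<^bsup>jk\<^esup>\<bar> \<le> q\<^bsup>k(k-1)/2\<^esup>\<close> gives a summable majorant uniform in \<open>j\<close>, whatever \<open>u\<close> is.
\<close>

lemma upper_swap:
  "(\<lambda>k. vwp_coeff \<alpha> b c u k
      * (\<Sum>j. Q ^ j * upper_weight d e f \<tau> j * (node_poly (Q ^ j) k * qinf (\<alpha> * Q ^ Suc k * Q ^ j))))
    sums (\<Sum>j. Q ^ j * upper_weight d e f \<tau> j * vwp_sum \<alpha> b c u (Q ^ j))"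
proof -
  obtain C where C: "C > 0" "\<And>k. norm (vwp_coeff \<alpha> b c u k) \<le> C * norm u ^ k"
    using vwp_coeff_bound[OF well_poised alpha nz(1,2)] by auto
  define M where "M = exp (norm \<alpha> / (1 - q))"
  show ?thesis
  proof (rule vwp_swap[OF upper_weight_convergent])
    show "summable (\<lambda>k. C * M * (norm u ^ k * (\<Prod>i<k. q ^ i)))"
      by (intro summable_mult summable_gaussian)
    fix j k
    have "norm (\<alpha> * Q ^ Suc k * Q ^ j) = norm \<alpha> * q ^ (Suc k + j)"
    by (simp add: norm_mult norm_power power_add)
  also have "\<dots> \<le> norm \<alpha>"
    using q_pow_le_1[of "Suc k + j"] by (intro mult_left_le) auto
  finally have 1: "norm (qinf (\<alpha> * Q ^ Suc k * Q ^ j)) \<le> M"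
      unfolding M_def by (rule norm_qinf_le)
    have prod_q: "0 \<le> (\<Prod>i<k. q ^ i)"
      using q_pos by (intro prod_nonneg) auto
    have "norm (vwp_term \<alpha> b c u (Q ^ j) k)
        = norm (vwp_coeff \<alpha> b c u k) * norm (node_poly (Q ^ j) k) * norm (qinf (\<alpha> * Q ^ Suc k * Q ^ j))"
      by (simp add: vwp_term_def norm_mult)
    also have "\<dots> \<le> (C * norm u ^ k) * (\<Prod>i<k. q ^ i) * M"
      using C(1) prod_q by (intro mult_mono C(2) 1 norm_node_poly_Q_pow_le) auto
    finally show "norm (vwp_term \<alpha> b c u (Q ^ j) k) \<le> C * M * (norm u ^ k * (\<Prod>i<k. q ^ i))"
      by (simp add: mult_ac)
  qed
qed

text \<open>
  Here all nodes satisfy \<open>\<bar>t\<bar> \<le> \<bar>\<tau>\<bar>\<close>, so the majorant is geometric with ratio \<open>\<bar>u\<tau>\<bar>\<close>.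
\<close>

lemma lower_swap:
  "(\<lambda>k. vwp_coeff \<alpha> b c u k
      * (\<Sum>j. Q ^ j * lower_weight d e f \<tau> j * (node_poly (\<tau> * Q ^ j) k * qinf (\<alpha> * Q ^ Suc k * (\<tau> * Q ^ j)))))
    sums (\<Sum>j. Q ^ j * lower_weight d e f \<tau> j * vwp_sum \<alpha> b c u (\<tau> * Q ^ j))"
proof -
  have "norm \<tau> > 0" using tau by simp
  then obtain C where C: "\<And>t k. norm t \<le> norm \<tau> \<Longrightarrow> norm (vwp_term \<alpha> b c u t k) \<le> C * (norm u * norm \<tau>) ^ k"
    using vwp_term_bound[OF well_poised alpha nz(1,2)] by blast
  show ?thesis
  proof (rule vwp_swap[OF lower_weight_convergent])
    show "summable (\<lambda>k. C * (norm u * norm \<tau>) ^ k)"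
      using conv by (intro summable_mult summable_geometric) (simp add: norm_mult abs_mult)
    show "norm (vwp_term \<alpha> b c u (\<tau> * Q ^ j) k) \<le> C * (norm u * norm \<tau>) ^ k" for j k
      using q_pow_le_1[of j] by (intro C) (simp add: norm_mult norm_power mult_left_le)
  qed
qed

lemma inner_difference:
  "node_lead k * (qfin d k * qfin e k * qfin f k) * (Q ^ k * (\<Sum>i. Q ^ i * upper_term \<tau> (Q ^ k) d e f i))
     - \<tau> * (qinf d * qinf e * qinf f) * (node_lead k * (\<Sum>j. Q ^ j * lower_term \<tau> (Q ^ k) d e f j))
   = \<tau> ^ k * (qfin d k * qfin e k * qfin f k)
     * (qinf Q * qinf (Q / \<tau>) * qinf \<tau> * (qinf (\<tau> * d * e * Q ^ k) * qinf (\<tau> * d * f * Q ^ k) * qinf (\<tau> * e * f * Q ^ k))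
        / (qinf (\<tau> * d) * qinf (\<tau> * e) * qinf (\<tau> * f)))"
proof -
  have Q0: "Q ^ k \<noteq> 0" by simp
  have sp: "qinf x = qfin x k * qinf (Q ^ k * x)" for x
    using qinf_split[of x k] by (simp add: mult.commute)
  have "node_lead k * (qfin d k * qfin e k * qfin f k) * (Q ^ k * (\<Sum>i. Q ^ i * upper_term \<tau> (Q ^ k) d e f i))
     - \<tau> * (qinf d * qinf e * qinf f) * (node_lead k * (\<Sum>j. Q ^ j * lower_term \<tau> (Q ^ k) d e f j))
    = node_lead k * (qfin d k * qfin e k * qfin f k) * saal_integral \<tau> (Q ^ k) d e f"
    unfolding saal_integral_def sp[of d] sp[of e] sp[of f] by algebra
  also have "\<dots> = (node_lead k * Q ^ k * (qinf (Q ^ k / \<tau> * Q) * qinf (\<tau> / Q ^ k))) * (qfin d k * qfin e k * qfin f k)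
     * (qinf Q * (qinf (\<tau> * d * e * Q ^ k) * qinf (\<tau> * d * f * Q ^ k) * qinf (\<tau> * e * f * Q ^ k))
        / (qinf (\<tau> * d) * qinf (\<tau> * e) * qinf (\<tau> * f)))"
    unfolding nonterminating_saalschuetz[OF tau Q0 nz(3-5)] by (simp add: mult_ac)
  also have "\<dots> = \<tau> ^ k * (qfin d k * qfin e k * qfin f k)
     * (qinf Q * qinf (Q / \<tau>) * qinf \<tau> * (qinf (\<tau> * d * e * Q ^ k) * qinf (\<tau> * d * f * Q ^ k) * qinf (\<tau> * e * f * Q ^ k))
        / (qinf (\<tau> * d) * qinf (\<tau> * e) * qinf (\<tau> * f)))"
    unfolding theta_shift[OF tau nz(6)] by (simp add: mult_ac)
  finally show ?thesis .
qed

lemma integral_eq_vwp_series: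
  assumes nz': "qinf (\<tau> * d * e) \<noteq> 0" "qinf (\<tau> * d * f) \<noteq> 0" "qinf (\<tau> * e * f) \<noteq> 0"
  shows "(\<lambda>k. vwp_coeff \<alpha> b c u k * \<tau> ^ k * (qfin d k * qfin e k * qfin f k)
        / (qfin (\<tau> * d * e) k * qfin (\<tau> * d * f) k * qfin (\<tau> * e * f) k)
        * (qinf Q * qinf (Q / \<tau>) * qinf \<tau> * (qinf (\<tau> * d * e) * qinf (\<tau> * d * f) * qinf (\<tau> * e * f))
        / (qinf (\<tau> * d) * qinf (\<tau> * e) * qinf (\<tau> * f))))
    sums ((\<Sum>j. Q ^ j * upper_weight d e f \<tau> j * vwp_sum \<alpha> b c u (Q ^ j))
      - \<tau> * (qinf d * qinf e * qinf f) * (\<Sum>j. Q ^ j * lower_weight d e f \<tau> j * vwp_sum \<alpha> b c u (\<tau> * Q ^ j)))"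
proof -
  have *: "v * \<tau> ^ k * (qfin d k * qfin e k * qfin f k)
        / (qfin (\<tau> * d * e) k * qfin (\<tau> * d * f) k * qfin (\<tau> * e * f) k)
        * (qinf Q * qinf (Q / \<tau>) * qinf \<tau> * (qinf (\<tau> * d * e) * qinf (\<tau> * d * f) * qinf (\<tau> * e * f))
        / (qinf (\<tau> * d) * qinf (\<tau> * e) * qinf (\<tau> * f)))
    = v * (\<tau> ^ k * (qfin d k * qfin e k * qfin f k)
     * (qinf Q * qinf (Q / \<tau>) * qinf \<tau> * (qinf (\<tau> * d * e * Q ^ k) * qinf (\<tau> * d * f * Q ^ k) * qinf (\<tau> * e * f * Q ^ k))
        / (qinf (\<tau> * d) * qinf (\<tau> * e) * qinf (\<tau> * f))))" for v k
    unfolding qinf_divide_shift[OF nz'(1)] qinf_divide_shift[OF nz'(2)] qinf_divide_shift[OF nz'(3)]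
    by (simp add: mult_ac)
  show ?thesis
    unfolding * inner_difference[symmetric] right_diff_distrib
    by (rule sums_cong[THEN iffD1, OF _ sums_diff[OF upper_swap sums_mult[OF lower_swap, of "\<tau> * (qinf d * qinf e * qinf f)"]]])
       (unfold upper_inner lower_inner, simp only: mult_ac)
qed

end

text \<open>
  The left side is the q-integral computed term by term, the right side the same integral with
  \<open>vwp_sum\<close> evaluated at the nodes. In the usual notation \<open>u = \<alpha>q/(bc)\<close> and \<open>\<tau> = \<alpha>q/(def)\<close>, so that
  \<open>q/\<tau> = def/\<alpha>\<close>, \<open>\<tau>d = \<alpha>q/(ef)\<close> and \<open>\<tau>de = \<alpha>q/f\<close>. The equation is kept free of quotients by
  \<open>(d, e, f, u; q)\<^sub>\<infinity>\<close>, which may vanish.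
\<close>

theorem nonterminating_watson:
  assumes well_poised: "\<alpha> * Q = u * b * c" and balanced: "\<tau> * d * e * f = \<alpha> * Q"
    and alpha: "\<alpha> \<noteq> 1" and tau: "\<tau> \<noteq> 0"
    and conv: "norm (u * \<tau>) < 1"
    and nz: "qinf (u * b) \<noteq> 0" "qinf (u * c) \<noteq> 0" "qinf (\<tau> * d) \<noteq> 0" "qinf (\<tau> * e) \<noteq> 0"
      "qinf (\<tau> * f) \<noteq> 0" "qinf (Q / \<tau>) \<noteq> 0"
    and nz': "qinf (\<tau> * d * e) \<noteq> 0" "qinf (\<tau> * d * f) \<noteq> 0" "qinf (\<tau> * e * f) \<noteq> 0"
    and nz2: "qinf (\<tau> * Q) \<noteq> 0" "qinf (u * b * \<tau>) \<noteq> 0" "qinf (u * c * \<tau>) \<noteq> 0"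
  shows "(\<Sum>k. vwp_coeff \<alpha> b c u k * \<tau> ^ k * (qfin d k * qfin e k * qfin f k)
        / (qfin (\<tau> * d * e) k * qfin (\<tau> * d * f) k * qfin (\<tau> * e * f) k))
      * (qinf Q * qinf (Q / \<tau>) * qinf \<tau> * (qinf (\<tau> * d * e) * qinf (\<tau> * d * f) * qinf (\<tau> * e * f))
        / (qinf (\<tau> * d) * qinf (\<tau> * e) * qinf (\<tau> * f)))
    = qinf (\<alpha> * Q) * qinf Q * qinf (Q / \<tau>)
        * (\<Sum>j. qfin d j * qfin e j * qfin f j * qfin u j
            / (qfin Q j * qfin (Q / \<tau>) j * qfin (u * b) j * qfin (u * c) j) * Q ^ j)
      - \<tau> * (qinf d * qinf e * qinf f)
        * (qinf (\<alpha> * Q) * qinf u * qinf (u * b * \<tau>) * qinf (u * c * \<tau>) * qinf Q * qinf (\<tau> * Q)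
           / (qinf (u * b) * qinf (u * c) * qinf (u * \<tau>) * (qinf (\<tau> * d) * qinf (\<tau> * e) * qinf (\<tau> * f))))
        * (\<Sum>j. qfin (\<tau> * d) j * qfin (\<tau> * e) j * qfin (\<tau> * f) j * qfin (u * \<tau>) j
            / (qfin Q j * qfin (\<tau> * Q) j * qfin (u * b * \<tau>) j * qfin (u * c * \<tau>) j) * Q ^ j)"
proof -
  let ?g = "\<lambda>k. vwp_coeff \<alpha> b c u k * \<tau> ^ k * (qfin d k * qfin e k * qfin f k)
        / (qfin (\<tau> * d * e) k * qfin (\<tau> * d * f) k * qfin (\<tau> * e * f) k)"
  define N where "N = qinf Q * qinf (Q / \<tau>) * qinf \<tau> * (qinf (\<tau> * d * e) * qinf (\<tau> * d * f) * qinf (\<tau> * e * f))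
        / (qinf (\<tau> * d) * qinf (\<tau> * e) * qinf (\<tau> * f))"
  define up where "up j = upper_weight d e f \<tau> j * vwp_sum \<alpha> b c u (Q ^ j)" for j
  define lo where "lo j = lower_weight d e f \<tau> j * vwp_sum \<alpha> b c u (\<tau> * Q ^ j)" for j
  have "(\<lambda>k. ?g k * N) sums ((\<Sum>j. Q ^ j * up j) - \<tau> * (qinf d * qinf e * qinf f) * (\<Sum>j. Q ^ j * lo j))"
    using integral_eq_vwp_series[OF well_poised balanced alpha tau conv nz nz']
    unfolding N_def up_def lo_def by (simp only: mult.assoc)
  then have series: "suminf ?g * N = (\<Sum>j. Q ^ j * up j) - \<tau> * (qinf d * qinf e * qinf f) * (\<Sum>j. Q ^ j * lo j)"
  \<comment> \<open>If the constant vanishes, the integral is the sum of a zero series; otherwise dividing by it shows that the unscaled series converges.\<close>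
  proof (cases "N = 0")
    case False
    assume s: "(\<lambda>k. ?g k * N) sums ((\<Sum>j. Q ^ j * up j) - \<tau> * (qinf d * qinf e * qinf f) * (\<Sum>j. Q ^ j * lo j))"
    then have "summable (\<lambda>k. N * ?g k)" by (simp add: sums_iff mult.commute)
    then have "summable ?g" using False by (rule summable_mult_D)
    then have "suminf ?g * N = (\<Sum>k. ?g k * N)" by (rule suminf_mult2)
    with s show ?thesis by (simp add: sums_iff)
  qed (auto simp: sums_iff)
  define g1 where "g1 j = qfin d j * qfin e j * qfin f j * qfin u j
      / (qfin Q j * qfin (Q / \<tau>) j * qfin (u * b) j * qfin (u * c) j)" for j
  define g2 where "g2 j = qfin (\<tau> * d) j * qfin (\<tau> * e) j * qfin (\<tau> * f) j * qfin (u * \<tau>) j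
      / (qfin Q j * qfin (\<tau> * Q) j * qfin (u * b * \<tau>) j * qfin (u * c * \<tau>) j)" for j
  have "g1 \<longlonglongrightarrow> qinf d * qinf e * qinf f * qinf u / (qinf Q * qinf (Q / \<tau>) * qinf (u * b) * qinf (u * c))"
    unfolding g1_def using nz by (intro tendsto_intros qfin_tendsto) auto
  from convergentI[OF this] have s1: "summable (\<lambda>j. Q ^ j * g1 j)" by (rule summable_Q_pow_mult)
  have "g2 \<longlonglongrightarrow> qinf (\<tau> * d) * qinf (\<tau> * e) * qinf (\<tau> * f) * qinf (u * \<tau>)
      / (qinf Q * qinf (\<tau> * Q) * qinf (u * b * \<tau>) * qinf (u * c * \<tau>))"
    unfolding g2_def using nz2 by (intro tendsto_intros qfin_tendsto) auto
  from convergentI[OF this] have s2: "summable (\<lambda>j. Q ^ j * g2 j)" by (rule summable_Q_pow_mult)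
  have up: "Q ^ j * up j = qinf (\<alpha> * Q) * qinf Q * qinf (Q / \<tau>) * (Q ^ j * g1 j)" for j
    unfolding up_def upper_weight_def vwp_sum_Q_pow[OF well_poised alpha nz(1,2)] g1_def
      qinf_divide_shift[OF qinf_Q_nz] qinf_divide_shift[OF nz(6)]
    by (simp add: mult_ac)
  define K where "K = qinf (\<alpha> * Q) * qinf u * qinf (u * b * \<tau>) * qinf (u * c * \<tau>) * qinf Q * qinf (\<tau> * Q)
           / (qinf (u * b) * qinf (u * c) * qinf (u * \<tau>) * (qinf (\<tau> * d) * qinf (\<tau> * e) * qinf (\<tau> * f)))"
  have lo: "Q ^ j * lo j = K * (Q ^ j * g2 j)" for j
  proof -
    have "norm (u * (\<tau> * Q ^ j)) \<le> norm (u * \<tau>)"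
      using q_pow_le_1[of j] by (simp add: norm_mult norm_power mult_left_le mult_left_mono)
    then have c: "norm (u * (\<tau> * Q ^ j)) < 1" using conv by linarith
    have sh: "u * b * (\<tau> * Q ^ j) = u * b * \<tau> * Q ^ j" "u * c * (\<tau> * Q ^ j) = u * c * \<tau> * Q ^ j"
      "u * (\<tau> * Q ^ j) = u * \<tau> * Q ^ j" by simp_all
    show ?thesis
      unfolding lo_def lower_weight_def vwp_sum_eq[OF well_poised alpha nz(1,2) c] g2_def K_def sh
        qinf_divide_shift[OF qinf_Q_nz] qinf_divide_shift[OF nz(3)] qinf_divide_shift[OF nz(4)]
        qinf_divide_shift[OF nz(5)] qinf_divide_shift[OF nz2(1)] qinf_divide_shift[OF nz2(2)]
        qinf_divide_shift[OF nz2(3)] qinf_divide_shift[OF qinf_nz_of_norm[OF conv]]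
      by (simp add: mult_ac)
  qed
  show ?thesis
    using series unfolding up lo suminf_mult[OF s1] suminf_mult[OF s2]
    unfolding N_def g1_def g2_def K_def by (simp only: mult_ac)
qed

section \<open>The two formulas for the Askey-Wilson function\<close>

lemma qpoch_eq: "qpoch q xs n = (\<Prod>x\<leftarrow>xs. qfin x n)"
  by (simp add: qpoch_def qfin_def)

lemma qpoch_inf_eq: "qpoch_inf q xs = (\<Prod>x\<leftarrow>xs. qinf x)"
  by (simp add: qpoch_inf_def qinf_def)

text \<open>
  The number \<open>A\<close> stands for the dual parameter of \<open>a\<close>. Keeping it independent of the principal square
  root lets \<open>a\<close> and \<open>A\<close> change places, and lets the formulas be compared at parameters whose duals are
  known only algebraically.
\<close>

definition AW_phi :: "complex \<Rightarrow> complex \<Rightarrow> complex \<Rightarrow> complex \<Rightarrow> complex \<Rightarrow> complex \<Rightarrow> complex \<Rightarrow> complex" where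
  "AW_phi a b c d A \<gamma> z =
     (let D = a * d / A in
        qhyp q [a * z, a / z, A * \<gamma>, A / \<gamma>] [a * b, a * c, a * d] Q
        + qpoch_inf q [a * z, a / z, A * \<gamma>, A / \<gamma>, Q * b / d, Q * c / d, Q / (a * d)]
          / qpoch_inf q [Q * z / d, Q / (d * z), Q * \<gamma> / D, Q / (D * \<gamma>), a * b, a * c, a * d / Q]
          * qhyp q [Q * z / d, Q / (d * z), Q * \<gamma> / D, Q / (D * \<gamma>)]
              [Q * b / d, Q * c / d, Q\<^sup>2 / (a * d)] Q)"

definition AW_vwp :: "complex \<Rightarrow> complex \<Rightarrow> complex \<Rightarrow> complex \<Rightarrow> complex \<Rightarrow> complex \<Rightarrow> complex \<Rightarrow> complex" where
  "AW_vwp a b c d A \<gamma> z =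
        qpoch_inf q [Q * \<gamma> * A * z / d, Q * \<gamma> * A / (d * z), Q * a / d, Q / (a * d)]
        / qpoch_inf q [Q * \<gamma> * A * a / d, \<gamma> * b * c / A, Q * z / d, Q / (d * z)]
        * W87 q (\<gamma> * A * a / d) [a * z, a / z, \<gamma> * A, \<gamma> * a * b / A, \<gamma> * a * c / A]"

lemma AW_phi43_eq: "AW_phi43 q a b c d = AW_phi a b c d (dual_a q a b c d)"
  by (intro ext) (simp add: AW_phi43_def AW_phi_def dual_d_def Let_def)

lemma AW_W87_eq: "AW_W87 q a b c d = AW_vwp a b c d (dual_a q a b c d)"
  by (intro ext) (simp add: AW_W87_def AW_vwp_def Let_def)

lemma AW_phi_dual:
  assumes "a \<noteq> 0" "A \<noteq> 0" "d \<noteq> 0"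
  shows "AW_phi a b c d A \<gamma> z = AW_phi A (a * b / A) (a * c / A) (a * d / A) a z \<gamma>"
proof -
  have "A * (a * d / A) / a = d" "A * (a * b / A) = a * b" "A * (a * c / A) = a * c" "A * (a * d / A) = a * d"
    "Q * (a * b / A) / (a * d / A) = Q * b / d" "Q * (a * c / A) / (a * d / A) = Q * c / d"
    using assms by (simp_all add: field_simps)
  then show ?thesis
    unfolding AW_phi_def Let_def qhyp_def qpoch_eq qpoch_inf_eq by (simp add: mult_ac)
qed

text \<open>
  Watson's transformation with \<open>\<alpha> = \<gamma>Aa/d\<close>, \<open>u = A/\<gamma>\<close>, \<open>\<tau> = q/(ad)\<close> and \<open>d, e, f = az, a/z, \<gamma>A\<close>. Its
  convergence condition \<open>\<bar>u\<tau>\<bar> < 1\<close> is \<open>\<bar>\<gamma>\<bar> > \<bar>q/d'\<bar>\<close>.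
\<close>

lemma AW_vwp_eq_phi:
  assumes nz: "a \<noteq> 0" "b \<noteq> 0" "c \<noteq> 0" "d \<noteq> 0" "A \<noteq> 0" "\<gamma> \<noteq> 0" "z \<noteq> 0"
    and A: "A * A * Q = a * b * c * d"
    and params: "qinf (a * b) \<noteq> 0" "qinf (a * c) \<noteq> 0" "qinf (a * d / Q) \<noteq> 0" "qinf (Q * a / d) \<noteq> 0"
      "qinf (Q * b / d) \<noteq> 0" "qinf (Q * c / d) \<noteq> 0" "qinf (Q\<^sup>2 / (a * d)) \<noteq> 0"
    and poles: "qinf (Q * z / d) \<noteq> 0" "qinf (Q / (d * z)) \<noteq> 0" "qinf (Q * \<gamma> * A / (a * d)) \<noteq> 0"
    and dom: "qinf (\<gamma> * A * a / d) \<noteq> 0" "qinf (Q * \<gamma> * A * z / d) \<noteq> 0" "qinf (Q * \<gamma> * A / (d * z)) \<noteq> 0"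
    and conv: "norm (A * Q / (\<gamma> * a * d)) < 1"
  shows "AW_vwp a b c d A \<gamma> z = AW_phi a b c d A \<gamma> z"
proof -
  define \<alpha> where "\<alpha> = \<gamma> * A * a / d"
  define B where "B = \<gamma> * a * b / A"
  define C where "C = \<gamma> * a * c / A"
  define u where "u = A / \<gamma>"
  define \<tau> where "\<tau> = Q / (a * d)"
  have \<alpha>: "\<alpha> * Q = Q * \<gamma> * A * a / d" by (simp add: \<alpha>_def)
  have tau: "\<tau> \<noteq> 0" using nz by (simp add: \<tau>_def)
  have wp: "\<alpha> * Q = u * B * C"
  proof -
    have "\<alpha> * Q = \<gamma> * a * (A * A * Q) / (A * d)" using nz by (simp add: \<alpha>_def)
    then show ?thesis unfolding A using nz by (simp add: u_def B_def C_def)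
  qed
  have bal: "\<tau> * (a * z) * (a / z) * (\<gamma> * A) = \<alpha> * Q"
    using nz by (simp add: \<tau>_def \<alpha>_def)
  have al1: "\<alpha> \<noteq> 1" using dom(1) by (auto simp: \<alpha>_def)
  have e: "u * B = a * b" "u * C = a * c" "\<tau> * (a * z) = Q * z / d" "\<tau> * (a / z) = Q / (d * z)"
    "\<tau> * (\<gamma> * A) = Q * \<gamma> * A / (a * d)" "Q / \<tau> = a * d"
    using nz by (simp_all add: u_def B_def C_def \<tau>_def field_simps)
  have e2: "Q * z / d * (a / z) = Q * a / d" "Q * z / d * (\<gamma> * A) = Q * \<gamma> * A * z / d"
    "Q / (d * z) * (\<gamma> * A) = Q * \<gamma> * A / (d * z)" "\<tau> * Q = Q\<^sup>2 / (a * d)"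
    "a * b * \<tau> = Q * b / d" "a * c * \<tau> = Q * c / d" "u * \<tau> = A * Q / (\<gamma> * a * d)"
    using nz by (simp_all add: u_def \<tau>_def field_simps power2_eq_square)
  have one_tau: "1 - a * d / Q \<noteq> 0" and ad: "qinf (a * d) \<noteq> 0"
    using params(3) qinf_step[of "a * d / Q"] by auto
  note watson = nonterminating_watson[OF wp bal al1 tau, unfolded e e2, OF conv params(1,2) poles ad
      params(4) dom(2,3) params(7,5,6)]
  define S where "S = (\<Sum>k. vwp_coeff \<alpha> B C u k * \<tau> ^ k * (qfin (a * z) k * qfin (a / z) k * qfin (\<gamma> * A) k)
        / (qfin (Q * a / d) k * qfin (Q * \<gamma> * A * z / d) k * qfin (Q * \<gamma> * A / (d * z)) k))"
  have W: "W87 q \<alpha> [a * z, a / z, \<gamma> * A, B, C] = S"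
    unfolding W87_def S_def
  proof (rule suminf_cong)
    fix k
    have 1: "Q * \<alpha> / (a * z) = Q * \<gamma> * A / (d * z)" "Q * \<alpha> / (a / z) = Q * \<gamma> * A * z / d"
      "Q * \<alpha> / (\<gamma> * A) = Q * a / d"
      using nz by (simp_all add: \<alpha>_def field_simps)
    have BC: "B \<noteq> 0" "C \<noteq> 0" using nz by (simp_all add: B_def C_def)
    have 2: "Q * \<alpha> / B = a * c" "Q * \<alpha> / C = a * b"
      using wp BC nz by (simp_all add: mult.commute[of Q] e[symmetric])
    have 3: "(of_real q)\<^sup>2 * \<alpha>\<^sup>2 / (prod_list [a * z, a / z, \<gamma> * A, B, C]) = u * \<tau>"
    proof -
      have "Q\<^sup>2 * \<alpha>\<^sup>2 = (\<alpha> * Q) * (\<alpha> * Q)" by (simp add: power2_eq_square)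
      also have "\<dots> = (u * B * C) * (\<tau> * (a * z) * (a / z) * (\<gamma> * A))" unfolding bal wp by simp
      finally show ?thesis using BC nz by (simp add: field_simps)
    qed
    show "(1 - \<alpha> * Q ^ (2 * k)) / (1 - \<alpha>) * (qpoch q (\<alpha> # [a * z, a / z, \<gamma> * A, B, C]) k
        / qpoch q (Q # map (\<lambda>\<beta>. Q * \<alpha> / \<beta>) [a * z, a / z, \<gamma> * A, B, C]) k)
        * (Q\<^sup>2 * \<alpha>\<^sup>2 / prod_list [a * z, a / z, \<gamma> * A, B, C]) ^ k
      = vwp_coeff \<alpha> B C u k * \<tau> ^ k * (qfin (a * z) k * qfin (a / z) k * qfin (\<gamma> * A) k)
        / (qfin (Q * a / d) k * qfin (Q * \<gamma> * A * z / d) k * qfin (Q * \<gamma> * A / (d * z)) k)"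
      unfolding 3 qpoch_eq vwp_coeff_def list.map 1 2 e by (simp add: power_mult_distrib mult_ac)
  qed
  have bcA: "\<gamma> * b * c / A = Q * \<gamma> * A / (a * d)"
  proof -
    have "\<gamma> * (A * A * Q) / (A * a * d) = \<gamma> * b * c / A" unfolding A using nz by simp
    then show ?thesis using nz by (simp add: mult_ac)
  qed
  have D: "Q * \<gamma> / (a * d / A) = Q * \<gamma> * A / (a * d)" "Q / (a * d / A * \<gamma>) = A * Q / (\<gamma> * a * d)"
    using nz by (simp_all add: field_simps)
  define F1 where "F1 = (\<Sum>j. qfin (a * z) j * qfin (a / z) j * qfin (\<gamma> * A) j * qfin u j
            / (qfin Q j * qfin (a * d) j * qfin (a * b) j * qfin (a * c) j) * Q ^ j)"
  define F2 where "F2 = (\<Sum>j. qfin (Q * z / d) j * qfin (Q / (d * z)) j * qfin (Q * \<gamma> * A / (a * d)) j * qfin (A * Q / (\<gamma> * a * d)) j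
            / (qfin Q j * qfin (Q\<^sup>2 / (a * d)) j * qfin (Q * b / d) j * qfin (Q * c / d) j) * Q ^ j)"
  have P1: "qhyp q [a * z, a / z, A * \<gamma>, A / \<gamma>] [a * b, a * c, a * d] Q = F1"
    unfolding qhyp_def F1_def qpoch_eq u_def by (simp add: mult_ac)
  have P2: "qhyp q [Q * z / d, Q / (d * z), Q * \<gamma> * A / (a * d), A * Q / (\<gamma> * a * d)]
              [Q * b / d, Q * c / d, Q\<^sup>2 / (a * d)] Q = F2"
    unfolding qhyp_def F2_def qpoch_eq by (simp add: mult_ac)
  \<comment> \<open>The factor \<open>- \<tau>\<close> in front of the second series is absorbed by \<open>(1 - \<tau>) / (1 - 1/\<tau>) = - \<tau>\<close>.\<close>
  have qt: "qinf \<tau> = - \<tau> * (1 - a * d / Q) * qinf (Q\<^sup>2 / (a * d))"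
  proof -
    have "qinf \<tau> = (1 - \<tau>) * qinf (Q\<^sup>2 / (a * d))" using qinf_step[of \<tau>] e2(4) by simp
    moreover have "1 - \<tau> = - \<tau> * (1 - a * d / Q)" using nz by (simp add: \<tau>_def field_simps)
    ultimately show ?thesis by simp
  qed
  have adQ: "qinf (a * d / Q) = (1 - a * d / Q) * qinf (a * d)"
    using qinf_step[of "a * d / Q"] by simp
  have alQ: "qinf (Q * \<gamma> * A * a / d) \<noteq> 0"
    using dom(1) qinf_step[of "\<gamma> * A * a / d"] by (auto simp: mult_ac)
  define K where "K = qinf (Q * \<gamma> * A * a / d) * qinf Q * qinf (a * d)"
  have K: "K \<noteq> 0" unfolding K_def using alQ ad by simp
  define T where "T = - \<tau> * qinf (Q\<^sup>2 / (a * d)) / qinf (a * d)"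
  have T: "qinf \<tau> / qinf (a * d / Q) = T"
    unfolding qt adQ T_def using one_tau by simp
  have L: "AW_vwp a b c d A \<gamma> z * K = S * (qinf Q * qinf (a * d) * qinf \<tau>
      * (qinf (Q * a / d) * qinf (Q * \<gamma> * A * z / d) * qinf (Q * \<gamma> * A / (d * z)))
      / (qinf (Q * z / d) * qinf (Q / (d * z)) * qinf (Q * \<gamma> * A / (a * d))))"
  proof -
    have "AW_vwp a b c d A \<gamma> z =
        qinf (Q * \<gamma> * A * z / d) * qinf (Q * \<gamma> * A / (d * z)) * qinf (Q * a / d) * qinf \<tau>
        / (qinf (Q * \<gamma> * A * a / d) * qinf (Q * \<gamma> * A / (a * d)) * qinf (Q * z / d) * qinf (Q / (d * z))) * S"
      unfolding AW_vwp_def bcA W[symmetric] \<alpha>_def B_def C_def \<tau>_def qpoch_inf_eq by (simp add: mult_ac)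
    then show ?thesis unfolding K_def using alQ by (simp add: mult_ac)
  qed
  have R: "AW_phi a b c d A \<gamma> z * K = qinf (\<alpha> * Q) * qinf Q * qinf (a * d) * F1
      - \<tau> * (qinf (a * z) * qinf (a / z) * qinf (\<gamma> * A))
        * (qinf (\<alpha> * Q) * qinf u * qinf (Q * b / d) * qinf (Q * c / d) * qinf Q * qinf (Q\<^sup>2 / (a * d))
           / (qinf (a * b) * qinf (a * c) * qinf (A * Q / (\<gamma> * a * d))
              * (qinf (Q * z / d) * qinf (Q / (d * z)) * qinf (Q * \<gamma> * A / (a * d))))) * F2"
  proof -
    have phi: "AW_phi a b c d A \<gamma> z = F1 + (qinf \<tau> / qinf (a * d / Q))
        * (qinf (a * z) * qinf (a / z) * qinf (\<gamma> * A) * qinf u * qinf (Q * b / d) * qinf (Q * c / d)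
           / (qinf (Q * z / d) * qinf (Q / (d * z)) * qinf (Q * \<gamma> * A / (a * d)) * qinf (A * Q / (\<gamma> * a * d))
              * qinf (a * b) * qinf (a * c))) * F2"
      unfolding AW_phi_def Let_def D P1 P2 qpoch_inf_eq \<tau>_def u_def by (simp add: mult_ac)
    show ?thesis
      unfolding phi T T_def K_def \<alpha> using ad by (simp add: algebra_simps)
  qed
  have "AW_vwp a b c d A \<gamma> z * K = AW_phi a b c d A \<gamma> z * K"
    unfolding L R using watson unfolding S_def F1_def F2_def \<alpha> by (simp only: mult_ac)
  then show ?thesis using K by simp
qed

section \<open>Continuation in the spectral parameter\<close>

lemma symmetric_series_holomorphic:
  assumes "convergent X"
  shows "(\<lambda>\<gamma>. \<Sum>k. Q ^ k * (X k * (qfin (x * \<gamma>) k * qfin (x / \<gamma>) k))) holomorphic_on - {0}"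
proof (rule holomorphic_uniform_sequence)
  obtain C where C: "\<And>k. norm (X k) \<le> C"
    using convergent_imp_Bseq[OF assms] by (auto simp: Bseq_def)
  have C0: "0 \<le> C" using C[of 0] norm_ge_zero order_trans by blast
  show "open (- {0::complex})" by (intro open_Compl) simp
  show "(\<lambda>\<gamma>. \<Sum>k<n. Q ^ k * (X k * (qfin (x * \<gamma>) k * qfin (x / \<gamma>) k))) holomorphic_on - {0}" for n
    unfolding qfin_def by (intro holomorphic_intros) auto
  fix g :: complex assume "g \<in> - {0}"
  then have g: "0 < norm g" by simp
  define r where "r = norm g / 2"
  have lo: "r \<le> norm y" and hi: "norm y \<le> 2 * norm g" if "y \<in> cball g r" for y
    using that norm_triangle_ineq2[of g y] norm_triangle_ineq2[of y g] g
    by (auto simp: r_def dist_norm norm_minus_commute)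
  define M where "M = exp (norm x * (2 * norm g) / (1 - q)) * exp (norm x / r / (1 - q))"
  have "uniform_limit (cball g r) (\<lambda>n \<gamma>. \<Sum>k<n. Q ^ k * (X k * (qfin (x * \<gamma>) k * qfin (x / \<gamma>) k)))
      (\<lambda>\<gamma>. \<Sum>k. Q ^ k * (X k * (qfin (x * \<gamma>) k * qfin (x / \<gamma>) k))) sequentially"
  proof (rule Weierstrass_m_test)
    show "summable (\<lambda>k. q ^ k * (C * M))"
      by (intro summable_mult2 summable_q_pow)
    fix k y assume y: "y \<in> cball g r"
    have "norm (x * y) \<le> norm x * (2 * norm g)"
      using hi[OF y] by (simp add: norm_mult mult_left_mono)
    moreover have "norm (x / y) \<le> norm x / r"
      unfolding norm_divide using lo[OF y] g by (intro frac_le) (auto simp: r_def)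
    ultimately have "norm (qfin (x * y) k) * norm (qfin (x / y) k) \<le> M"
      unfolding M_def by (intro mult_mono norm_qfin_le) auto
    then have "norm (X k) * (norm (qfin (x * y) k) * norm (qfin (x / y) k)) \<le> C * M"
      using C C0 by (intro mult_mono) auto
    then show "norm (Q ^ k * (X k * (qfin (x * y) k * qfin (x / y) k))) \<le> q ^ k * (C * M)"
      using q_pos by (simp add: norm_mult norm_power)
  qed
  moreover have "0 < r" "cball g r \<subseteq> - {0}"
    using g lo by (fastforce simp: r_def)+
  ultimately show "\<exists>d>0. cball g d \<subseteq> - {0} \<and> uniform_limit (cball g d)
     (\<lambda>n \<gamma>. \<Sum>k<n. Q ^ k * (X k * (qfin (x * \<gamma>) k * qfin (x / \<gamma>) k)))
      (\<lambda>\<gamma>. \<Sum>k. Q ^ k * (X k * (qfin (x * \<gamma>) k * qfin (x / \<gamma>) k))) sequentially"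
    by blast
qed

lemma qinf_mult_zeros_countable:
  assumes "x \<noteq> 0"
  shows "countable {\<gamma>. qinf (x * \<gamma>) = 0}"
proof (rule countable_subset)
  show "{\<gamma>. qinf (x * \<gamma>) = 0} \<subseteq> range (\<lambda>n. 1 / (x * Q ^ n))"
    using assms by (auto simp: qinf_eq_0_iff field_simps)
qed simp

lemma connected_punctured_plane: "connected (- {0 :: complex})"
  by (rule connected_punctured_universe) simp

text \<open>
  The \<open>4\<phi>3\<close> formula times its only denominators that depend on \<open>\<gamma>\<close>, multiplied out so as to be defined
  at every nonzero \<open>\<gamma>\<close>. In terms of \<open>D = ad/A\<close> the number \<open>qA/(ad)\<close> is \<open>q/D\<close>.
\<close>

definition AW_cleared ::
  "complex \<Rightarrow> complex \<Rightarrow> complex \<Rightarrow> complex \<Rightarrow> complex \<Rightarrow> complex \<Rightarrow> complex \<Rightarrow> complex" where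
  "AW_cleared a b c d A z \<gamma> =
     qinf (Q * A / (a * d) * \<gamma>) * qinf (Q * A / (a * d) / \<gamma>)
       * (\<Sum>k. Q ^ k * (qfin (a * z) k * qfin (a / z) k / (qfin (a * b) k * qfin (a * c) k * qfin (a * d) k * qfin Q k)
            * (qfin (A * \<gamma>) k * qfin (A / \<gamma>) k)))
     + qinf (a * z) * qinf (a / z) * qinf (Q * b / d) * qinf (Q * c / d) * qinf (Q / (a * d))
         / (qinf (Q * z / d) * qinf (Q / (d * z)) * qinf (a * b) * qinf (a * c) * qinf (a * d / Q))
       * (qinf (A * \<gamma>) * qinf (A / \<gamma>))
       * (\<Sum>k. Q ^ k * (qfin (Q * z / d) k * qfin (Q / (d * z)) k
              / (qfin (Q * b / d) k * qfin (Q * c / d) k * qfin (Q\<^sup>2 / (a * d)) k * qfin Q k)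
            * (qfin (Q * A / (a * d) * \<gamma>) k * qfin (Q * A / (a * d) / \<gamma>) k)))"

lemma AW_phi_times_denominator:
  assumes "qinf (Q * A / (a * d) * \<gamma>) \<noteq> 0" "qinf (Q * A / (a * d) / \<gamma>) \<noteq> 0"
  shows "AW_phi a b c d A \<gamma> z * (qinf (Q * A / (a * d) * \<gamma>) * qinf (Q * A / (a * d) / \<gamma>))
    = AW_cleared a b c d A z \<gamma>"
proof -
  have D: "Q * \<gamma> / (a * d / A) = Q * A / (a * d) * \<gamma>" "Q / (a * d / A * \<gamma>) = Q * A / (a * d) / \<gamma>"
    by simp_all
  show ?thesis
    unfolding AW_phi_def Let_def D AW_cleared_def qhyp_def qpoch_eq qpoch_inf_eq
    using assms by (simp add: algebra_simps)
qed

lemma AW_cleared_holomorphic: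
  assumes "qinf (a * b) \<noteq> 0" "qinf (a * c) \<noteq> 0" "qinf (a * d / Q) \<noteq> 0"
      "qinf (Q * b / d) \<noteq> 0" "qinf (Q * c / d) \<noteq> 0" "qinf (Q\<^sup>2 / (a * d)) \<noteq> 0"
  shows "AW_cleared a b c d A z holomorphic_on - {0}"
proof -
  have ad: "qinf (a * d) \<noteq> 0" using assms(3) qinf_step[of "a * d / Q"] by auto
  have "(\<lambda>k. qfin (a * z) k * qfin (a / z) k / (qfin (a * b) k * qfin (a * c) k * qfin (a * d) k * qfin Q k))
      \<longlonglongrightarrow> qinf (a * z) * qinf (a / z) / (qinf (a * b) * qinf (a * c) * qinf (a * d) * qinf Q)"
    using assms ad by (intro tendsto_intros qfin_tendsto) auto
  note 1 = symmetric_series_holomorphic[OF convergentI[OF this], of A]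
  have "(\<lambda>k. qfin (Q * z / d) k * qfin (Q / (d * z)) k
          / (qfin (Q * b / d) k * qfin (Q * c / d) k * qfin (Q\<^sup>2 / (a * d)) k * qfin Q k))
      \<longlonglongrightarrow> qinf (Q * z / d) * qinf (Q / (d * z))
          / (qinf (Q * b / d) * qinf (Q * c / d) * qinf (Q\<^sup>2 / (a * d)) * qinf Q)"
    using assms by (intro tendsto_intros qfin_tendsto) auto
  note 2 = symmetric_series_holomorphic[OF convergentI[OF this], of "Q * A / (a * d)"]
  have "(\<lambda>\<gamma>. x * \<gamma>) holomorphic_on - {0}" "(\<lambda>\<gamma>. x / \<gamma>) holomorphic_on - {0}" for x :: complex
    by (intro holomorphic_intros; simp)+
  from this[THEN holomorphic_on_compose[OF _ qinf_holomorphic]]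
  have q: "(\<lambda>\<gamma>. qinf (x * \<gamma>)) holomorphic_on - {0}" "(\<lambda>\<gamma>. qinf (x / \<gamma>)) holomorphic_on - {0}" for x
    by (simp_all add: o_def)
  show ?thesis
    unfolding AW_cleared_def[abs_def] by (intro holomorphic_intros 1 2 q)
qed

section \<open>The symmetries\<close>

lemma W87_permute: "W87 q \<alpha> [x1, x2, x3, x4, x5] = W87 q \<alpha> [x1, x2, x4, x3, x5]"
  unfolding W87_def qpoch_eq by (simp add: mult_ac)

lemma AW_vwp_symmetry:
  assumes nz: "a \<noteq> 0" "b \<noteq> 0" "c \<noteq> 0" "d \<noteq> 0" "A \<noteq> 0"
    and A: "A * A * Q = a * b * c * d"
    and nz': "qinf (a * c) \<noteq> 0" "qinf (c / a) \<noteq> 0" "qinf (c * z) \<noteq> 0" "qinf (c / z) \<noteq> 0"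
  shows "AW_vwp a b c d A \<gamma> z =
    qinf (Q * a / d) * qinf (Q / (a * d)) / (qinf (a * c) * qinf (c / a))
    * (qinf (c * z) * qinf (c / z) / (qinf (Q * z / d) * qinf (Q / (d * z))))
    * AW_vwp a b (Q / d) (Q / c) (a * b / A) \<gamma> z"
proof -
  have bc: "b * c = A * A * Q / (a * d)" using A nz by simp
  have "Q * \<gamma> * (a * b / A) * z / (Q / c) = \<gamma> * a * z * (b * c) / A"
    "Q * \<gamma> * (a * b / A) / (Q / c * z) = \<gamma> * a * (b * c) / (A * z)"
    "Q * \<gamma> * (a * b / A) * a / (Q / c) = \<gamma> * a * a * (b * c) / A"
    "\<gamma> * (a * b / A) * a / (Q / c) = \<gamma> * a * a * (b * c) / (A * Q)"
    using nz by (simp_all add: field_simps)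
  then have 1: "Q * \<gamma> * (a * b / A) * z / (Q / c) = Q * \<gamma> * A * z / d"
    "Q * \<gamma> * (a * b / A) / (Q / c * z) = Q * \<gamma> * A / (d * z)"
    "Q * \<gamma> * (a * b / A) * a / (Q / c) = Q * \<gamma> * A * a / d"
    "\<gamma> * (a * b / A) * a / (Q / c) = \<gamma> * A * a / d"
    unfolding bc using nz by (simp_all add: field_simps)
  have "\<gamma> * b * c / A = \<gamma> * (b * c) / A" by simp
  then have "\<gamma> * b * c / A = Q * \<gamma> * A / (a * d)"
    unfolding bc using nz by simp
  moreover have "\<gamma> * b * (Q / d) / (a * b / A) = Q * \<gamma> * A / (a * d)"
    using nz by (simp add: field_simps)
  ultimately have 2: "\<gamma> * b * (Q / d) / (a * b / A) = \<gamma> * b * c / A" by simp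
  have 3: "\<gamma> * a * (Q / d) / (a * b / A) = \<gamma> * a * c / A"
  proof -
    have e1: "\<gamma> * a * c / A = \<gamma> * a * (b * c) / (A * b)" using nz by simp
    have e2: "\<gamma> * a * (A * A * Q / (a * d)) / (A * b) = \<gamma> * a * (Q / d) / (a * b / A)"
      using nz by (simp add: field_simps)
    show ?thesis by (simp only: e1 bc e2)
  qed
  have 4: "\<gamma> * a * b / (a * b / A) = \<gamma> * A" "\<gamma> * (a * b / A) = \<gamma> * a * b / A"
    "Q * a / (Q / c) = a * c" "Q / (a * (Q / c)) = c / a" "Q * z / (Q / c) = c * z" "Q / (Q / c * z) = c / z"
    using nz by (simp_all add: field_simps)
  show ?thesis
    unfolding AW_vwp_def 1
    unfolding 2 3 4 qpoch_inf_eq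
    unfolding W87_permute[of _ _ _ "\<gamma> * A"]
    using nz' by (simp add: mult_ac)
qed

text \<open>
  Both sides have the same denominators in \<open>\<gamma>\<close>, because \<open>D\<close> is also the dual of \<open>q/c\<close> in the new
  quadruple. After clearing them both are holomorphic in \<open>\<gamma> \<noteq> 0\<close>, and they agree on the nonempty open
  set of large \<open>\<gamma>\<close> where the very-well-poised formula applies to each.
\<close>

lemma AW_phi_symmetry:
  assumes nz: "a \<noteq> 0" "b \<noteq> 0" "c \<noteq> 0" "d \<noteq> 0" "A \<noteq> 0" "\<gamma> \<noteq> 0" "z \<noteq> 0"
    and A: "A * A * Q = a * b * c * d"
    and params: "qinf (a * b) \<noteq> 0" "qinf (a * c) \<noteq> 0" "qinf (a * d / Q) \<noteq> 0" "qinf (Q * a / d) \<noteq> 0"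
      "qinf (Q * b / d) \<noteq> 0" "qinf (Q * c / d) \<noteq> 0" "qinf (Q\<^sup>2 / (a * d)) \<noteq> 0"
    and params': "qinf (a / c) \<noteq> 0" "qinf (b * c) \<noteq> 0" "qinf (Q * c / a) \<noteq> 0" "qinf (c / a) \<noteq> 0"
    and poles: "qinf (Q * z / d) \<noteq> 0" "qinf (Q / (d * z)) \<noteq> 0" "qinf (c * z) \<noteq> 0" "qinf (c / z) \<noteq> 0"
      "qinf (Q * A / (a * d) * \<gamma>) \<noteq> 0" "qinf (Q * A / (a * d) / \<gamma>) \<noteq> 0"
  shows "AW_phi a b c d A \<gamma> z =
    qinf (Q * a / d) * qinf (Q / (a * d)) / (qinf (a * c) * qinf (c / a))
    * (qinf (c * z) * qinf (c / z) / (qinf (Q * z / d) * qinf (Q / (d * z))))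
    * AW_phi a b (Q / d) (Q / c) (a * b / A) \<gamma> z"
proof -
  define K where "K = qinf (Q * a / d) * qinf (Q / (a * d)) / (qinf (a * c) * qinf (c / a))
    * (qinf (c * z) * qinf (c / z) / (qinf (Q * z / d) * qinf (Q / (d * z))))"
  define x where "x = Q * A / (a * d)"
  define R where "R = norm x"
  have bc: "b * c = A * A * Q / (a * d)" using A nz by simp
  have x': "Q * (a * b / A) / (a * (Q / c)) = x"
  proof -
    have "Q * (a * b / A) / (a * (Q / c)) = b * c / A" using nz by simp
    then show ?thesis unfolding bc x_def using nz by simp
  qed
  have A': "a * b / A * (a * b / A) * Q = a * b * (Q / d) * (Q / c)"
  proof -
    have "a * b / A * (a * b / A) * Q = a * b * (a * b) * Q * Q / (A * A * Q)" using nz by simp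
    then show ?thesis unfolding A using nz by (simp add: field_simps)
  qed
  have n': "Q / d \<noteq> 0" "Q / c \<noteq> 0" "a * b / A \<noteq> 0" using nz by auto
  have p': "a * (Q / c) / Q = a / c" "Q * a / (Q / c) = a * c" "Q * b / (Q / c) = b * c"
    "Q * (Q / d) / (Q / c) = Q * c / d" "Q\<^sup>2 / (a * (Q / c)) = Q * c / a"
    "Q * z / (Q / c) = c * z" "Q / (Q / c * z) = c / z" "a * (Q / d) = Q * a / d"
    using nz by (simp_all add: field_simps power2_eq_square)
  \<comment> \<open>Here the very-well-poised formula holds for both quadruples at once.\<close>
  define U where "U = {\<gamma>. R < norm \<gamma>} \<inter> {\<gamma>. qinf (A * a / d * \<gamma>) * qinf (Q * A * z / d * \<gamma>)
      * qinf (Q * A / (d * z) * \<gamma>) * qinf (x * \<gamma>) \<noteq> 0}"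
  have "AW_cleared a b c d A z \<gamma> = K * AW_cleared a b (Q / d) (Q / c) (a * b / A) z \<gamma>"
  proof (rule analytic_continuation_open[where s = U and s' = "- {0}" and f = "AW_cleared a b c d A z"
        and g = "\<lambda>\<gamma>. K * AW_cleared a b (Q / d) (Q / c) (a * b / A) z \<gamma>"])
    have cont: "continuous_on UNIV (\<lambda>\<gamma>. qinf (y * \<gamma>))" for y
      by (rule continuous_on_compose2[OF holomorphic_on_imp_continuous_on[OF qinf_holomorphic[of UNIV]]])
         (simp_all add: continuous_on_mult_left)
    show "open U"
      unfolding U_def
    proof (rule open_Int)
      show "open {\<gamma> :: complex. R < norm \<gamma>}"
        by (intro open_Collect_less continuous_on_const continuous_on_norm_id)
      show "open {\<gamma>. qinf (A * a / d * \<gamma>) * qinf (Q * A * z / d * \<gamma>)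
          * qinf (Q * A / (d * z) * \<gamma>) * qinf (x * \<gamma>) \<noteq> 0}"
        by (rule open_Collect_neq[OF _ continuous_on_const])
           (rule continuous_on_mult[OF continuous_on_mult[OF continuous_on_mult[OF cont cont] cont] cont])
    qed
    have R0: "0 \<le> R" by (simp add: R_def)
    show "U \<subseteq> - {0}" using R0 by (auto simp: U_def)
    let ?Z = "\<lambda>y. {\<gamma>. qinf (y * \<gamma>) = 0}"
    define Bad where "Bad = ?Z (A * a / d) \<union> ?Z (Q * A * z / d) \<union> ?Z (Q * A / (d * z)) \<union> ?Z x"
    \<comment> \<open>All but countably many points are good: the zeros of each factor form a geometric sequence.\<close>
    have "countable Bad"
      unfolding Bad_def using nz by (intro countable_Un qinf_mult_zeros_countable) (auto simp: x_def)
    moreover have "uncountable (ball (of_real (R + 2) :: complex) 1)"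
      by (rule uncountable_ball) simp
    ultimately have "\<not> ball (of_real (R + 2)) 1 \<subseteq> Bad"
      by (metis countable_subset)
    then obtain g where g: "g \<in> ball (of_real (R + 2)) 1" "g \<notin> Bad" by (meson subsetI)
    have "R < norm g"
      using g(1) norm_triangle_ineq2[of "of_real (R + 2)" g] R0 by (simp add: dist_norm)
    then show "U \<noteq> {}" using g(2) unfolding U_def Bad_def by auto
    show "connected (- {0 :: complex})" by (rule connected_punctured_plane)
    show "open (- {0 :: complex})" by (intro open_Compl) simp
    show "AW_cleared a b c d A z holomorphic_on - {0}"
      by (rule AW_cleared_holomorphic[OF params(1-3,5-7)])
    show "(\<lambda>\<gamma>. K * AW_cleared a b (Q / d) (Q / c) (a * b / A) z \<gamma>) holomorphic_on - {0}"
      by (intro holomorphic_intros AW_cleared_holomorphic, unfold p')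
         (rule params params')+
    show "\<gamma> \<in> - {0}" using nz by simp
  next
    fix g assume "g \<in> U"
    then have g: "R < norm g" "qinf (A * a / d * g) \<noteq> 0" "qinf (Q * A * z / d * g) \<noteq> 0"
        "qinf (Q * A / (d * z) * g) \<noteq> 0" "qinf (x * g) \<noteq> 0"
      by (auto simp: U_def)
    have g0: "g \<noteq> 0" using g(1) by (auto simp: R_def)
    have small: "norm (x / g) < 1" using g(1) g0 by (simp add: norm_divide R_def)
    have eqs: "Q * g * A / (a * d) = x * g" "g * A * a / d = A * a / d * g"
      "Q * g * A * z / d = Q * A * z / d * g" "Q * g * A / (d * z) = Q * A / (d * z) * g"
      "A * Q / (g * a * d) = x / g"
      by (simp_all add: x_def mult_ac)
    have e1: "AW_vwp a b c d A g z = AW_phi a b c d A g z"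
      by (rule AW_vwp_eq_phi[OF nz(1-5) g0 nz(7) A params poles(1,2)]) (unfold eqs, (rule g small)+)
    have eqs': "Q * g * (a * b / A) / (a * (Q / c)) = x * g" "a * b / A * Q / (g * a * (Q / c)) = x / g"
      unfolding x'[symmetric] by simp_all
    have eqs'': "g * (a * b / A) * a / (Q / c) = A * a / d * g"
      "Q * g * (a * b / A) * z / (Q / c) = Q * A * z / d * g"
      "Q * g * (a * b / A) / (Q / c * z) = Q * A / (d * z) * g"
    proof -
      have "g * (a * b / A) * a / (Q / c) = g * a * a * (b * c) / (A * Q)"
        "Q * g * (a * b / A) * z / (Q / c) = g * a * z * (b * c) / A"
        "Q * g * (a * b / A) / (Q / c * z) = g * a * (b * c) / (A * z)"
        using nz by (simp_all add: field_simps)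
      then show "g * (a * b / A) * a / (Q / c) = A * a / d * g"
        "Q * g * (a * b / A) * z / (Q / c) = Q * A * z / d * g"
        "Q * g * (a * b / A) / (Q / c * z) = Q * A / (d * z) * g"
        unfolding bc using nz by simp_all
    qed
    have e2: "AW_vwp a b (Q / d) (Q / c) (a * b / A) g z = AW_phi a b (Q / d) (Q / c) (a * b / A) g z"
      by (rule AW_vwp_eq_phi[OF nz(1,2) n' g0 nz(7) A'])
         (unfold p' eqs' eqs'', (rule params params' poles g small)+)
    have "AW_phi a b c d A g z = K * AW_phi a b (Q / d) (Q / c) (a * b / A) g z"
      unfolding e1[symmetric] e2[symmetric] K_def
      by (rule AW_vwp_symmetry[OF nz(1-5) A params(2) params'(4) poles(3,4)])
    moreover have "AW_phi a b c d A g z * (qinf (x * g) * qinf (x / g)) = AW_cleared a b c d A z g"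
      unfolding x_def using AW_phi_times_denominator g(5) qinf_nz_of_norm[OF small] by (simp add: x_def)
    moreover have "AW_phi a b (Q / d) (Q / c) (a * b / A) g z * (qinf (x * g) * qinf (x / g))
        = AW_cleared a b (Q / d) (Q / c) (a * b / A) z g"
      using AW_phi_times_denominator[of "a * b / A" a "Q / c" g b "Q / d" z] g(5) qinf_nz_of_norm[OF small]
      unfolding x' by simp
    ultimately show "AW_cleared a b c d A z g = K * AW_cleared a b (Q / d) (Q / c) (a * b / A) z g"
      by (metis mult.assoc)
  qed
  then have "AW_phi a b c d A \<gamma> z * (qinf (x * \<gamma>) * qinf (x / \<gamma>))
      = K * AW_phi a b (Q / d) (Q / c) (a * b / A) \<gamma> z * (qinf (x * \<gamma>) * qinf (x / \<gamma>))"
    using AW_phi_times_denominator[of A a d \<gamma> b c z] AW_phi_times_denominator[of "a * b / A" a "Q / c" \<gamma> b "Q / d" z]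
      poles(5,6) unfolding x' x_def[symmetric] by simp
  then have "AW_phi a b c d A \<gamma> z = K * AW_phi a b (Q / d) (Q / c) (a * b / A) \<gamma> z"
    using poles(5,6) unfolding x_def[symmetric] by simp
  then show ?thesis unfolding K_def .
qed

text \<open>
  The first symmetry at the dual parameters \<open>A, B, C, D\<close>. Passing to the duals once more turns
  \<open>(A, B, q/D, q/C)\<close> into \<open>(b, a, c, d)\<close>.
\<close>

lemma AW_phi_symmetry_dual:
  assumes nz: "a \<noteq> 0" "b \<noteq> 0" "c \<noteq> 0" "d \<noteq> 0" "A \<noteq> 0" "\<gamma> \<noteq> 0" "z \<noteq> 0"
    and A: "A * A * Q = a * b * c * d"
    and params: "qinf (a * b) \<noteq> 0" "qinf (a * c) \<noteq> 0" "qinf (a * d / Q) \<noteq> 0" "qinf (b * c) \<noteq> 0"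
      "qinf (Q * b / d) \<noteq> 0" "qinf (Q * c / d) \<noteq> 0" "qinf (Q\<^sup>2 / (a * d)) \<noteq> 0"
    and params': "qinf (b * d / Q) \<noteq> 0" "qinf (Q * a / d) \<noteq> 0" "qinf (Q\<^sup>2 / (b * d)) \<noteq> 0" "qinf (Q / (b * d)) \<noteq> 0"
    and poles: "qinf (Q * A / (a * d) * \<gamma>) \<noteq> 0" "qinf (Q * A / (a * d) / \<gamma>) \<noteq> 0"
      "qinf (a * c / A * \<gamma>) \<noteq> 0" "qinf (a * c / A / \<gamma>) \<noteq> 0"
      "qinf (Q * z / d) \<noteq> 0" "qinf (Q / (d * z)) \<noteq> 0"
  shows "AW_phi a b c d A \<gamma> z =
    qinf (b * c) * qinf (Q / (a * d)) / (qinf (a * c) * qinf (Q / (b * d)))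
    * (qinf (a * c / A * \<gamma>) * qinf (a * c / A / \<gamma>) / (qinf (Q * A / (a * d) * \<gamma>) * qinf (Q * A / (a * d) / \<gamma>)))
    * AW_phi b a c d A \<gamma> z"
proof -
  define B C D where "B = a * b / A" "C = a * c / A" "D = a * d / A"
  note defs = B_C_D_def
  have n: "B \<noteq> 0" "C \<noteq> 0" "D \<noteq> 0" using nz by (auto simp: defs)
  have AB: "A * B = a * b" "A * C = a * c" "A * D = a * d" "A * B / a = b"
    "Q * B / D = Q * b / d" "Q * C / D = Q * c / d"
    using nz by (simp_all add: defs)
  \<comment> \<open>The dual of the dual of \<open>a\<close> is \<open>a\<close>.\<close>
  have A': "a * a * Q = A * B * C * D"
  proof -
    have "A * B * C * D = (A * A * Q) * a * a * a * b * c * d * Q / ((A * A * Q) * (A * A * Q))"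
      using nz by (simp add: defs)
    then show ?thesis unfolding A using nz by simp
  qed
  have bc: "b * c = A * A * Q / (a * d)" and bd: "b * d = A * A * Q / (a * c)" using A nz by simp_all
  have BC: "B * C = Q * a / d"
  proof -
    have "B * C = a * a * (b * c) / (A * A)" by (simp add: defs)
    then show ?thesis unfolding bc using nz by simp
  qed
  have q: "Q * A / D = b * c" "A / C = b * d / Q" "Q * C / A = Q\<^sup>2 / (b * d)"
    "C / A = Q / (b * d)" "Q * a / (a * d) * z = Q * z / d" "Q * a / (a * d) / z = Q / (d * z)"
    "Q * \<gamma> / D = Q * A / (a * d) * \<gamma>" "Q / (D * \<gamma>) = Q * A / (a * d) / \<gamma>"
    "Q * A / (Q / C) = a * c"
    using nz unfolding bd bc by (simp_all add: defs field_simps power2_eq_square)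
  have "AW_phi a b c d A \<gamma> z = AW_phi A B C D a z \<gamma>"
    unfolding defs by (rule AW_phi_dual[OF nz(1,5,4)])
  also have "\<dots> = qinf (Q * A / D) * qinf (Q / (A * D)) / (qinf (A * C) * qinf (C / A))
    * (qinf (C * \<gamma>) * qinf (C / \<gamma>) / (qinf (Q * \<gamma> / D) * qinf (Q / (D * \<gamma>))))
    * AW_phi A B (Q / D) (Q / C) (A * B / a) z \<gamma>"
    by (rule AW_phi_symmetry[OF nz(5) n nz(1,7,6) A'])
       (unfold AB BC q, (rule params params' poles | unfold defs, rule poles)+)
  also have "AW_phi A B (Q / D) (Q / C) (A * B / a) z \<gamma> = AW_phi b a c d A \<gamma> z"
  proof -
    have 1: "B = b * a / A" by (simp add: defs)
    have 2: "Q / D = b * c / A" "Q / C = b * d / A"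
      unfolding bc bd using nz by (simp_all add: defs)
    show ?thesis unfolding AB(4) unfolding 1 2 by (rule AW_phi_dual[OF nz(2,5,4), symmetric])
  qed
  finally show ?thesis unfolding AB q by (simp only: defs)
qed

lemma AW_eq_phi:
  assumes nz: "a \<noteq> 0" "b \<noteq> 0" "c \<noteq> 0" "d \<noteq> 0"
    and params: "AW_defined q a b c d"
    and poles: "AW_pole_free q a b c d \<gamma> z"
  shows "AW q a b c d \<gamma> z = AW_phi a b c d (dual_a q a b c d) \<gamma> z"
proof (cases "AW_W87_dom q a b c d \<gamma> z")
  case True
  define A where "A = dual_a q a b c d"
  have A: "A * A * Q = a * b * c * d"
    using power2_csqrt[of "a * b * c * d / Q"] by (simp add: A_def dual_a_def power2_eq_square)
  have A0: "A \<noteq> 0" using A nz by auto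
  have D: "dual_d q a b c d = a * d / A" by (simp add: dual_d_def A_def)
  have gz: "\<gamma> \<noteq> 0" "z \<noteq> 0" using poles by (auto simp: AW_pole_free_def Let_def)
  have eq: "Q * \<gamma> / (a * d / A) = Q * \<gamma> * A / (a * d)" by simp
  have "norm (Q / (a * d / A)) < norm \<gamma>"
    using True by (simp add: AW_W87_dom_def D Let_def)
  moreover have "A * Q / (\<gamma> * a * d) = Q / (a * d / A) / \<gamma>" by (simp add: mult_ac)
  ultimately have conv: "norm (A * Q / (\<gamma> * a * d)) < 1"
    using gz by (simp only: norm_divide[of _ \<gamma>]) (simp add: divide_less_eq_1)
  have "AW_vwp a b c d A \<gamma> z = AW_phi a b c d A \<gamma> z"
    using params poles True gz
    by (intro AW_vwp_eq_phi[OF nz A0 gz A])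
       (auto simp: AW_defined_def AW_pole_free_def AW_W87_dom_def Let_def qpoch_inf_eq D eq A_def[symmetric] conv)
  then show ?thesis
    using True by (simp add: AW_def AW_W87_eq A_def)
next
  case False
  then show ?thesis by (simp add: AW_def AW_phi43_eq)
qed

end

text \<open>
  Squaring determines the dual parameter up to sign. With \<open>x\<^sup>2 = ab\<close> and \<open>y\<^sup>2 = cd\<close>, principal roots,
  both \<open>x\<close> and \<open>y\<close> lie in the open sector \<open>\<bar>arg\<bar> < \<pi>/4\<close>; hence \<open>xy\<close> and \<open>x/y\<close> stay in the right half
  plane, where roots are principal, and the two dual parameters are \<open>xy\<close> and \<open>x/y\<close> up to positive
  factors.
\<close>

lemma dual_a_companion:
  fixes q :: real and a b c d :: complex
  assumes q: "0 < q" and nz: "a \<noteq> 0" "b \<noteq> 0" "c \<noteq> 0" "d \<noteq> 0"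
    and re: "Re (a * b) > 0" "Re (c * d) > 0"
  shows "dual_a q a b (q / d) (q / c) = a * b / dual_a q a b c d"
proof -
  have half: "\<bar>Im (csqrt x)\<bar> < Re (csqrt x)" if "Re x > 0" for x
  proof -
    have "Re (w\<^sup>2) > 0 \<Longrightarrow> 0 \<le> Re w \<Longrightarrow> \<bar>Im w\<bar> < Re w" for w
      by (simp add: Re_power2) (metis abs_of_nonneg power2_abs power2_less_imp_less)
    from this[of "csqrt x"] show ?thesis using that Re_csqrt[of x] by (simp only: power2_csqrt)
  qed
  define x y s where "x = csqrt (a * b)" "y = csqrt (c * d)" "s = complex_of_real (sqrt q)"
  have sq: "x\<^sup>2 = a * b" "y\<^sup>2 = c * d" "s\<^sup>2 = of_real q"
    using q by (simp_all add: x_y_s_def flip: of_real_power)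
  have n: "x \<noteq> 0" "y \<noteq> 0" "s \<noteq> 0" using nz q by (auto simp: x_y_s_def)
  have s: "Re s > 0" "Im s = 0" using q by (simp_all add: x_y_s_def)
  have xy: "\<bar>Im x\<bar> < Re x" "\<bar>Im y\<bar> < Re y" using half[OF re(1)] half[OF re(2)] unfolding x_y_s_def .
  have less: "\<bar>Im x * Im y\<bar> < Re x * Re y"
    unfolding abs_mult using xy by (intro mult_strict_mono') auto
  have 1: "dual_a q a b c d = x * y / s"
    unfolding dual_a_def
  proof (rule csqrt_unique)
    show "(x * y / s)\<^sup>2 = a * b * c * d / of_real q"
      by (simp add: power_mult_distrib power_divide sq)
    have "Re (x * y / s) = Re (x * y) / Re s"
      using s by (simp add: complex_eq_iff Re_divide power2_eq_square)
    then show "0 < Re (x * y / s) \<or> Re (x * y / s) = 0 \<and> 0 \<le> Im (x * y / s)"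
      using less s by (auto simp: abs_if split: if_splits)
  qed
  have 2: "dual_a q a b (q / d) (q / c) = x * s / y"
    unfolding dual_a_def
  proof (rule csqrt_unique)
    show "(x * s / y)\<^sup>2 = a * b * (of_real q / d) * (of_real q / c) / of_real q"
      using q by (simp add: power_mult_distrib power_divide sq)
    have "Re (x * s / y) = Re s * (Re x * Re y + Im x * Im y) / ((Re y)\<^sup>2 + (Im y)\<^sup>2)"
      using s by (simp add: Re_divide algebra_simps)
    moreover have "0 < Re x * Re y + Im x * Im y" using less by linarith
    moreover have "0 < (Re y)\<^sup>2 + (Im y)\<^sup>2" using n by (simp add: complex_neq_0)
    ultimately have "0 < Re (x * s / y)" using s by simp
    then show "0 < Re (x * s / y) \<or> Re (x * s / y) = 0 \<and> 0 \<le> Im (x * s / y)" by simp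
  qed
  have "a * b / dual_a q a b c d = x\<^sup>2 / (x * y / s)" unfolding 1 sq by simp
  also have "\<dots> = x * s / y" using n by (simp add: power2_eq_square)
  finally show ?thesis unfolding 2 by simp
qed

theorem theorem6p1:
  fixes q :: real and a b c d :: complex
  assumes "0 < q" "q < 1"
    and "a \<noteq> 0" "b \<noteq> 0" "c \<noteq> 0" "d \<noteq> 0"
    and "Re a > 0" "Re b > 0" "Re c > 0" "Re d > 0"
    and "Re (a * b) > 0" "Re (a / b) > 0" "Re (c * d) > 0" "Re (c / d) > 0"
    and "generic_params q a b c d"
  shows
    "(\<forall>\<gamma> z. AW_pole_free q a b c d \<gamma> z \<longrightarrow> AW_pole_free q a b (q / d) (q / c) \<gamma> z \<longrightarrow>
        AW q a b c d \<gamma> z =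
          qpoch_inf q [q * a / d, q / (a * d)] / qpoch_inf q [a * c, c / a]
          * (qgauss q (q / d) z / qgauss q c z)
          * AW q a b (q / d) (q / c) \<gamma> z) \<and>
     (\<forall>\<gamma> z. AW_pole_free q a b c d \<gamma> z \<longrightarrow> AW_pole_free q b a c d \<gamma> z \<longrightarrow>
        AW q a b c d \<gamma> z =
          qpoch_inf q [b * c, q / (a * d)] / qpoch_inf q [a * c, q / (b * d)]
          * (qgauss q (q / dual_d q a b c d) \<gamma> / qgauss q (dual_c q a b c d) \<gamma>)
          * AW q b a c d \<gamma> z)"
proof -
  interpret q_calculus q by standard (use assms in auto)
  define A where "A = dual_a q a b c d"
  have nz: "a \<noteq> 0" "b \<noteq> 0" "c \<noteq> 0" "d \<noteq> 0" by fact+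
  have A: "A * A * Q = a * b * c * d"
    using power2_csqrt[of "a * b * c * d / Q"] by (simp add: A_def dual_a_def power2_eq_square)
  have A0: "A \<noteq> 0" using A nz by auto
  have A': "dual_a q a b (q / d) (q / c) = a * b / A"
    unfolding A_def using dual_a_companion[of q a b c d] assms by simp
  have A'': "dual_a q b a c d = A"
    by (simp add: A_def dual_a_def mult.commute[of b])
  have def1: "AW_defined q a b c d" and def2: "AW_defined q a b (q / d) (q / c)"
    and def3: "AW_defined q b a c d" and extra: "qinf (a * c) \<noteq> 0" "qinf (c / a) \<noteq> 0" "qinf (Q / (b * d)) \<noteq> 0"
    using assms(15) by (auto simp: generic_params_def qpoch_inf_eq)
  have p1: "qinf (a * b) \<noteq> 0" "qinf (a * c) \<noteq> 0" "qinf (a * d / Q) \<noteq> 0" "qinf (Q * a / d) \<noteq> 0"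
      "qinf (Q * b / d) \<noteq> 0" "qinf (Q * c / d) \<noteq> 0" "qinf (Q\<^sup>2 / (a * d)) \<noteq> 0"
    using def1 by (auto simp: AW_defined_def qpoch_inf_eq)
  have p2: "qinf (a / c) \<noteq> 0" "qinf (b * c) \<noteq> 0" "qinf (Q * c / a) \<noteq> 0"
  proof -
    have "a * (Q / c) / Q = a / c" "Q * b / (Q / c) = b * c" "Q\<^sup>2 / (a * (Q / c)) = Q * c / a"
      using nz by (simp_all add: power2_eq_square)
    then show "qinf (a / c) \<noteq> 0" "qinf (b * c) \<noteq> 0" "qinf (Q * c / a) \<noteq> 0"
      using def2 by (auto simp: AW_defined_def qpoch_inf_eq)
  qed
  have p3: "qinf (b * d / Q) \<noteq> 0" "qinf (Q\<^sup>2 / (b * d)) \<noteq> 0"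
    using def3 by (auto simp: AW_defined_def qpoch_inf_eq)
  have D: "dual_d q a b c d = a * d / A" "dual_c q a b c d = a * c / A"
    by (simp_all add: dual_d_def dual_c_def A_def)
  have free: "\<gamma> \<noteq> 0" "z \<noteq> 0" "qinf (Q * z / d) \<noteq> 0" "qinf (Q / (d * z)) \<noteq> 0"
      "qinf (Q * A / (a * d) * \<gamma>) \<noteq> 0" "qinf (Q * A / (a * d) / \<gamma>) \<noteq> 0"
    if "AW_pole_free q a b c d \<gamma> z" for \<gamma> z
  proof -
    have "Q * \<gamma> / (a * d / A) = Q * A / (a * d) * \<gamma>" "Q / (a * d / A * \<gamma>) = Q * A / (a * d) / \<gamma>"
      by simp_all
    then show "\<gamma> \<noteq> 0" "z \<noteq> 0" "qinf (Q * z / d) \<noteq> 0" "qinf (Q / (d * z)) \<noteq> 0"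
      "qinf (Q * A / (a * d) * \<gamma>) \<noteq> 0" "qinf (Q * A / (a * d) / \<gamma>) \<noteq> 0"
      using that unfolding AW_pole_free_def Let_def D by (auto simp: qpoch_inf_eq mult_ac)
  qed
  show ?thesis
  proof (intro conjI allI impI)
    fix \<gamma> z
    assume f1: "AW_pole_free q a b c d \<gamma> z" and f2: "AW_pole_free q a b (q / d) (q / c) \<gamma> z"
    note f = free[OF f1]
    have "Q * z / (Q / c) = c * z" "Q / (Q / c * z) = c / z" using nz by simp_all
    then have cz: "qinf (c * z) \<noteq> 0" "qinf (c / z) \<noteq> 0"
      using f2 unfolding AW_pole_free_def Let_def by (auto simp: qpoch_inf_eq mult_ac)
    have "AW q a b (q / d) (q / c) \<gamma> z = AW_phi a b (Q / d) (Q / c) (a * b / A) \<gamma> z"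
      unfolding A'[symmetric] by (rule AW_eq_phi) (use nz def2 f2 in auto)
    moreover have "AW q a b c d \<gamma> z = AW_phi a b c d A \<gamma> z"
      unfolding A_def by (rule AW_eq_phi[OF nz def1 f1])
    moreover have "qgauss q (q / d) z / qgauss q c z
        = qinf (c * z) * qinf (c / z) / (qinf (Q * z / d) * qinf (Q / (d * z)))"
      by (simp add: qgauss_def qpoch_inf_eq mult_ac)
    ultimately show "AW q a b c d \<gamma> z =
          qpoch_inf q [q * a / d, q / (a * d)] / qpoch_inf q [a * c, c / a]
          * (qgauss q (q / d) z / qgauss q c z)
          * AW q a b (q / d) (q / c) \<gamma> z"
      using AW_phi_symmetry[OF nz A0 f(1,2) A p1 p2 extra(2) f(3,4) cz f(5,6)]
      by (simp add: qpoch_inf_eq)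
  next
    fix \<gamma> z
    assume f1: "AW_pole_free q a b c d \<gamma> z" and f2: "AW_pole_free q b a c d \<gamma> z"
    note f = free[OF f1]
    have "Q / (b * d / A) = a * c / A"
    proof -
      have "Q / (b * d / A) = A * A * Q / (A * b * d)" using A0 by simp
      then show ?thesis unfolding A using nz by simp
    qed
    then have "Q * \<gamma> / (b * d / A) = a * c / A * \<gamma>" "Q / (b * d / A * \<gamma>) = a * c / A / \<gamma>"
      by (metis times_divide_eq_left mult.commute, metis divide_divide_eq_left)
    moreover have "dual_d q b a c d = b * d / A" by (simp add: dual_d_def A'')
    ultimately have cg: "qinf (a * c / A * \<gamma>) \<noteq> 0" "qinf (a * c / A / \<gamma>) \<noteq> 0"
      using f2 unfolding AW_pole_free_def Let_def by (auto simp: qpoch_inf_eq mult_ac)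
    have "AW q b a c d \<gamma> z = AW_phi b a c d A \<gamma> z"
      unfolding A''[symmetric] by (rule AW_eq_phi[OF nz(2,1,3,4) def3 f2])
    moreover have "AW q a b c d \<gamma> z = AW_phi a b c d A \<gamma> z"
      unfolding A_def by (rule AW_eq_phi[OF nz def1 f1])
    moreover have "qgauss q (q / dual_d q a b c d) \<gamma> / qgauss q (dual_c q a b c d) \<gamma>
        = qinf (a * c / A * \<gamma>) * qinf (a * c / A / \<gamma>)
          / (qinf (Q * A / (a * d) * \<gamma>) * qinf (Q * A / (a * d) / \<gamma>))"
      unfolding D by (simp add: qgauss_def qpoch_inf_eq)
    ultimately show "AW q a b c d \<gamma> z =
          qpoch_inf q [b * c, q / (a * d)] / qpoch_inf q [a * c, q / (b * d)]
          * (qgauss q (q / dual_d q a b c d) \<gamma> / qgauss q (dual_c q a b c d) \<gamma>)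
          * AW q b a c d \<gamma> z"
      using AW_phi_symmetry_dual[OF nz A0 f(1,2) A p1(1-3) p2(2) p1(5-7) p3(1) p1(4) p3(2) extra(3)
          f(5,6) cg f(3,4)]
      by (simp add: qpoch_inf_eq)
  qed
qed

end
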